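(* Let $m\ge3$ be an odd integer and $n=2m$, and let $\lambda>\frac{2n-2}{n-2}$. Let $\varphi:(0,1)\to(0,1)$ be continuous with $\lim_{r\to0^+}\varphi(r)=0$. Then there exists a $C^\infty$ positive solution $u$ of $$0\le-\Delta^m u\le u^\lambda\quad\text{in }\mathbb{R}^n\setminus\{0\}$$ such that $u(x)\neq O\left(\varphi(|x|)|x|^{-(n-2)}\log\frac{5}{|x|}\right)$ as $x\to0$.
   Context: $\Delta^m$ is the $m$-fold iterated Laplacian. For positive functions, "$u(x)\neq O(h(x))$ as $x\to0$" means $\limsup_{x\to0} u(x)/h(x)=\infty$. *)

theory Defs
  imports "HOL-Analysis.Analysis"
begin

definition partial_deriv :: "'n::finite \<Rightarrow> (real^'n \<Rightarrow> real) \<Rightarrow> real^'n \<Rightarrow> real" where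
  "partial_deriv i f x = deriv (\<lambda>t. f (x + t *\<^sub>R axis i 1)) 0"

fun partial_derivs :: "'n::finite list \<Rightarrow> (real^'n \<Rightarrow> real) \<Rightarrow> real^'n \<Rightarrow> real" where
  "partial_derivs [] f = f"
| "partial_derivs (i # is) f = partial_deriv i (partial_derivs is f)"

definition smooth_on :: "(real^'n::finite \<Rightarrow> real) \<Rightarrow> (real^'n) set \<Rightarrow> bool" where
  "smooth_on f S \<longleftrightarrow> (\<forall>is. \<forall>x\<in>S. partial_derivs is f differentiable (at x))"

definition laplacian :: "(real^'n::finite \<Rightarrow> real) \<Rightarrow> real^'n \<Rightarrow> real" where
  "laplacian f x = (\<Sum>i\<in>UNIV. partial_deriv i (partial_deriv i f) x)"

definition iter_laplacian :: "nat \<Rightarrow> (real^'n::finite \<Rightarrow> real) \<Rightarrow> real^'n \<Rightarrow> real" where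
  "iter_laplacian m f = (laplacian ^^ m) f"

end

theory Submission
  imports Defs
begin

text \<open>
  In dimension \<open>2m\<close> the function \<open>- ln (|x - p|\<^sup>2 + b)\<close> is a bubble:
  \<open>(-\<Delta>)\<^sup>m\<close> maps it to \<open>4\<^sup>m b\<^sup>m (2m-1)! / (|x - p|\<^sup>2 + b)\<^bsup>2m\<^esup>\<close>, so everything can be built from
  logarithms without solving an equation. Fix points \<open>p\<^sub>j \<rightarrow> 0\<close>, put \<open>a = |p\<^sub>j|\<close>, and take the \<open>m\<close>-th
  difference with step \<open>a\<^sup>2\<close> of \<open>- ln\<close> at \<open>|x - p\<^sub>j|\<^sup>2 + b\<close>. It is positive, decays like \<open>|x|\<^bsup>-2m\<^esup>\<close>, and is of
  size \<open>ln (a\<^sup>2 / b)\<close> at \<open>p\<^sub>j\<close>. The bubbles of the difference that enter with the wrong sign are dominated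
  by one bubble \<open>- ln (|x|\<^sup>2 + a\<^sup>2)\<close> at the origin; subtracting its Taylor polynomial in \<open>a\<^sup>2\<close>, whose terms
  \<open>|x|\<^bsup>-2k\<^esup>\<close> with \<open>k < m\<close> are polyharmonic, makes it small for small \<open>a\<close>.

  The solution is the sum over \<open>j\<close> of these profiles with weights \<open>2\<^bsup>-j\<^esup> a\<^bsup>-(n-2)\<^esup>\<close>, plus a large multiple of
  \<open>|x|\<^bsup>-(n-2)\<^esup> + 1\<close>. The upper bound by \<open>u\<^sup>\<lambda>\<close> at the spike forces \<open>b\<^sup>m = a\<^bsup>(n-2)(\<lambda>-1)\<^esup>\<close>, and the hypothesis
  on \<open>\<lambda>\<close> says exactly that then \<open>b \<le> a\<^bsup>2+\<delta>\<^esup>\<close> for some \<open>\<delta> > 0\<close>. Hence \<open>u (p\<^sub>j)\<close> exceeds a constant times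
  \<open>2\<^bsup>-j\<^esup> a\<^bsup>-(n-2)\<^esup> ln (5/a)\<close>, and it suffices to choose \<open>\<phi> a \<le> 4\<^bsup>-j\<^esup>\<close>.
\<close>

section \<open>Partial derivatives and Laplacians\<close>

text \<open>A Frechet derivative with named coordinates \<open>D i\<close>. As a relation it can be
  computed by rules, and being a total derivative it yields differentiability as well as the values
  of \<open>partial_deriv\<close>.\<close>

definition has_partials :: "(real^'n::finite \<Rightarrow> real) \<Rightarrow> ('n \<Rightarrow> real^'n \<Rightarrow> real) \<Rightarrow> (real^'n) set \<Rightarrow> bool" where
  "has_partials f D S \<longleftrightarrow> (\<forall>x\<in>S. (f has_derivative (\<lambda>h. \<Sum>i\<in>UNIV. D i x * h $ i)) (at x))"

lemma has_partials_partial_deriv: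
  assumes "has_partials f D S" "x \<in> S"
  shows "partial_deriv i f x = D i x"
proof -
  have f: "(f has_derivative (\<lambda>h. \<Sum>i\<in>UNIV. D i x * h $ i)) (at (x + 0 *\<^sub>R axis i 1))"
    using assms by (auto simp: has_partials_def)
  have "((\<lambda>t. f (x + t *\<^sub>R axis i 1)) has_derivative (\<lambda>h. \<Sum>k\<in>UNIV. D k x * (h *\<^sub>R axis i 1) $ k)) (at 0)"
    by (rule has_derivative_compose[of "\<lambda>t. x + t *\<^sub>R axis i 1", OF _ f]) (auto intro!: derivative_eq_intros)
  moreover have "(\<lambda>h. \<Sum>k\<in>UNIV. D k x * (h *\<^sub>R axis i 1) $ k) = (\<lambda>h. h * D i x)"
    by (auto simp: axis_def if_distrib mult.commute cong: if_cong)
  ultimately have "((\<lambda>t. f (x + t *\<^sub>R axis i 1)) has_field_derivative D i x) (at 0)"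
    by (simp add: has_field_derivative_def mult_commute_abs)
  then show ?thesis
    by (simp add: partial_deriv_def DERIV_imp_deriv)
qed

lemma has_partials_differentiable:
  "has_partials f D S \<Longrightarrow> x \<in> S \<Longrightarrow> f differentiable (at x)"
  by (auto simp: has_partials_def differentiable_def)

lemma has_partials_cong:
  assumes "has_partials f D S" "open S" "\<And>x. x \<in> S \<Longrightarrow> g x = f x"
  shows "has_partials g D S"
  unfolding has_partials_def
proof
  fix x assume "x \<in> S"
  then show "(g has_derivative (\<lambda>h. \<Sum>i\<in>UNIV. D i x * h $ i)) (at x)"
    using assms has_derivative_transform_within_open[of f _ x UNIV S g]
    by (auto simp: has_partials_def)
qed

section \<open>Calculus rules for first derivatives\<close>

lemma has_partials_add:
  "has_partials f D S \<Longrightarrow> has_partials g E S \<Longrightarrow>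
    has_partials (\<lambda>x. f x + g x) (\<lambda>i x. D i x + E i x) S"
  unfolding has_partials_def
  by (auto intro!: derivative_eq_intros simp: algebra_simps sum.distrib)

lemma has_partials_cmult:
  "has_partials f D S \<Longrightarrow> has_partials (\<lambda>x. c * f x) (\<lambda>i x. c * D i x) S"
  unfolding has_partials_def
  by (auto intro!: derivative_eq_intros simp: algebra_simps sum_distrib_left)

lemma has_partials_const: "has_partials (\<lambda>x. c) (\<lambda>i x. 0) S"
  by (simp add: has_partials_def)

lemma has_partials_coord_mult:
  assumes "has_partials f D S"
  shows "has_partials (\<lambda>x. (x $ i - c) * f x) (\<lambda>k x. (if k = i then f x else 0) + (x $ i - c) * D k x) S"
  unfolding has_partials_def
proof
  fix x assume "x \<in> S"
  then have "(f has_derivative (\<lambda>h. \<Sum>k\<in>UNIV. D k x * h $ k)) (at x)"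
    using assms by (simp add: has_partials_def)
  then have *: "((\<lambda>x. (x $ i - c) * f x) has_derivative
      (\<lambda>h. (x $ i - c) * (\<Sum>k\<in>UNIV. D k x * h $ k) + h $ i * f x)) (at x)"
    by (auto intro!: derivative_eq_intros bounded_linear.has_derivative[OF bounded_linear_vec_nth])
  have "(\<lambda>h. (x $ i - c) * (\<Sum>k\<in>UNIV. D k x * h $ k) + h $ i * f x) =
    (\<lambda>h. \<Sum>k\<in>UNIV. ((if k = i then f x else 0) + (x $ i - c) * D k x) * h $ k)"
  proof
    fix h :: "real^'a"
    have "(\<Sum>k\<in>UNIV. ((if k = i then f x else 0) + (x $ i - c) * D k x) * h $ k) =
      (\<Sum>k\<in>UNIV. if k = i then f x * h $ k else 0) + (\<Sum>k\<in>UNIV. (x $ i - c) * (D k x * h $ k))"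
      by (subst sum.distrib[symmetric]) (auto intro!: sum.cong simp: algebra_simps)
    then show "(x $ i - c) * (\<Sum>k\<in>UNIV. D k x * h $ k) + h $ i * f x =
      (\<Sum>k\<in>UNIV. ((if k = i then f x else 0) + (x $ i - c) * D k x) * h $ k)"
      by (simp add: sum_distrib_left)
  qed
  with * show "((\<lambda>x. (x $ i - c) * f x) has_derivative
      (\<lambda>h. \<Sum>k\<in>UNIV. ((if k = i then f x else 0) + (x $ i - c) * D k x) * h $ k)) (at x)"
    by simp
qed

text \<open>Chain rule through |x - p|^2 + b, whose gradient is 2 (x - p). Each derivative of a
  radial function is a coordinate times a radial function, the shape on which
  \<open>chain_span\<close> rests.\<close>

lemma has_partials_radial:
  fixes p :: "real^'n::finite"
  assumes "\<And>x. x \<in> S \<Longrightarrow> (F has_real_derivative F' (norm (x - p) ^ 2 + b)) (at (norm (x - p) ^ 2 + b))"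
  shows "has_partials (\<lambda>x. F (norm (x - p) ^ 2 + b))
    (\<lambda>i x. 2 * ((x $ i - p $ i) * F' (norm (x - p) ^ 2 + b))) S"
  unfolding has_partials_def
proof
  fix x assume x: "x \<in> S"
  have inner: "((\<lambda>x. norm (x - p) ^ 2 + b) has_derivative (\<lambda>h. 2 * ((x - p) \<bullet> h))) (at x)"
    unfolding power2_norm_eq_inner by (auto intro!: derivative_eq_intros simp: inner_commute)
  have "((\<lambda>x. F (norm (x - p) ^ 2 + b)) has_derivative
      (\<lambda>h. F' (norm (x - p) ^ 2 + b) * (2 * ((x - p) \<bullet> h)))) (at x)"
    by (rule has_derivative_compose[OF inner assms[OF x, unfolded has_field_derivative_def]])
  then show "((\<lambda>x. F (norm (x - p) ^ 2 + b)) has_derivative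
      (\<lambda>h. \<Sum>i\<in>UNIV. 2 * ((x $ i - p $ i) * F' (norm (x - p) ^ 2 + b)) * h $ i)) (at x)"
    by (simp add: inner_vec_def sum_distrib_left algebra_simps)
qed

text \<open>Relational form with the second derivatives as witnesses, so that \<open>^^\<close>
  expresses iteration and linearity follows by induction. The image \<open>g\<close> is constrained
  on \<open>S\<close> only.\<close>

definition has_laplacian :: "(real^'n::finite) set \<Rightarrow> (real^'n \<Rightarrow> real) \<Rightarrow> (real^'n \<Rightarrow> real) \<Rightarrow> bool" where
  "has_laplacian S f g \<longleftrightarrow> (\<exists>D E. has_partials f D S \<and> (\<forall>i. has_partials (D i) (E i) S) \<and>
     (\<forall>x\<in>S. g x = (\<Sum>i\<in>UNIV. E i i x)))"

lemma partial_deriv_cong: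
  assumes "open S" "x \<in> S" "\<And>y. y \<in> S \<Longrightarrow> f y = g y"
  shows "partial_deriv i f x = partial_deriv i g x"
proof -
  have "\<forall>\<^sub>F t in nhds 0. x + t *\<^sub>R axis i 1 \<in> S"
  proof (rule topological_tendstoD[OF _ assms(1,2)])
    show "((\<lambda>t. x + t *\<^sub>R axis i 1) \<longlongrightarrow> x) (nhds 0)"
      by (auto intro!: tendsto_eq_intros filterlim_ident)
  qed
  then show ?thesis
    unfolding partial_deriv_def
    by (intro deriv_cong_ev) (auto elim!: eventually_mono simp: assms(3))
qed

lemma laplacian_cong:
  assumes "open S" "x \<in> S" "\<And>y. y \<in> S \<Longrightarrow> f y = g y"
  shows "laplacian f x = laplacian g x"
  unfolding laplacian_def
  by (intro sum.cong refl partial_deriv_cong[OF assms(1,2)] partial_deriv_cong[OF assms(1)] assms(3))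

lemma has_laplacian_laplacian:
  assumes "has_laplacian S f g" "open S" "x \<in> S"
  shows "laplacian f x = g x"
proof -
  obtain D E where D: "has_partials f D S" "\<And>i. has_partials (D i) (E i) S"
    "\<And>x. x \<in> S \<Longrightarrow> g x = (\<Sum>i\<in>UNIV. E i i x)"
    using assms(1) unfolding has_laplacian_def by auto
  have "partial_deriv i (partial_deriv i f) x = E i i x" for i
    using partial_deriv_cong[OF assms(2,3), of "partial_deriv i f" "D i" i]
      has_partials_partial_deriv[OF D(1)] has_partials_partial_deriv[OF D(2) assms(3)] by auto
  then show ?thesis
    by (simp add: laplacian_def D(3)[OF assms(3)])
qed

text \<open>Connects the relation with the operator \<open>iter_laplacian\<close>. Openness of
  \<open>S\<close> is what carries an equality on \<open>S\<close> through each further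
  Laplacian.\<close>

lemma iter_has_laplacian:
  assumes "(has_laplacian S ^^ p) f g" "open S" "x \<in> S"
  shows "iter_laplacian p f x = g x"
  using assms(1,3)
proof (induction p arbitrary: g x)
  case 0
  then show ?case by (simp add: iter_laplacian_def)
next
  case (Suc p)
  then obtain h where h: "(has_laplacian S ^^ p) f h" "has_laplacian S h g" by auto
  have "iter_laplacian (Suc p) f x = laplacian (iter_laplacian p f) x"
    by (simp add: iter_laplacian_def)
  also have "\<dots> = laplacian h x"
    by (rule laplacian_cong[OF assms(2) Suc.prems(2)]) (rule Suc.IH[OF h(1)])
  also have "\<dots> = g x"
    by (rule has_laplacian_laplacian[OF h(2) assms(2) Suc.prems(2)])
  finally show ?case .
qed

section \<open>Linearity of iterated Laplacians\<close>

lemma iter_has_laplacian_Suc: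
  "(has_laplacian S ^^ p) f g \<Longrightarrow> has_laplacian S g h \<Longrightarrow> (has_laplacian S ^^ Suc p) f h"
  by auto

lemma has_laplacian_add:
  assumes "has_laplacian S f g" "has_laplacian S f' g'"
  shows "has_laplacian S (\<lambda>x. f x + f' x) (\<lambda>x. g x + g' x)"
proof -
  obtain D E D' E' where *: "has_partials f D S" "\<And>i. has_partials (D i) (E i) S"
    "\<And>x. x \<in> S \<Longrightarrow> g x = (\<Sum>i\<in>UNIV. E i i x)"
    "has_partials f' D' S" "\<And>i. has_partials (D' i) (E' i) S"
    "\<And>x. x \<in> S \<Longrightarrow> g' x = (\<Sum>i\<in>UNIV. E' i i x)"
    using assms unfolding has_laplacian_def by blast
  show ?thesis
    unfolding has_laplacian_def
    by (rule exI[of _ "\<lambda>i x. D i x + D' i x"], rule exI[of _ "\<lambda>i k x. E i k x + E' i k x"])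
      (auto intro: has_partials_add * simp: sum.distrib *(3,6))
qed

lemma has_laplacian_cmult:
  assumes "has_laplacian S f g"
  shows "has_laplacian S (\<lambda>x. c * f x) (\<lambda>x. c * g x)"
proof -
  obtain D E where *: "has_partials f D S" "\<And>i. has_partials (D i) (E i) S"
    "\<And>x. x \<in> S \<Longrightarrow> g x = (\<Sum>i\<in>UNIV. E i i x)"
    using assms unfolding has_laplacian_def by blast
  show ?thesis
    unfolding has_laplacian_def
    by (rule exI[of _ "\<lambda>i x. c * D i x"], rule exI[of _ "\<lambda>i k x. c * E i k x"])
      (auto intro: has_partials_cmult * simp: sum_distrib_left *(3))
qed

lemma has_laplacian_const: "has_laplacian S (\<lambda>x. c) (\<lambda>x. 0)"
  unfolding has_laplacian_def
  by (rule exI[of _ "\<lambda>i x. 0"], rule exI[of _ "\<lambda>i k x. 0"]) (simp add: has_partials_const)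

lemma has_laplacian_sum:
  assumes "finite I" "\<And>i. i \<in> I \<Longrightarrow> has_laplacian S (f i) (g i)"
  shows "has_laplacian S (\<lambda>x. \<Sum>i\<in>I. f i x) (\<lambda>x. \<Sum>i\<in>I. g i x)"
  using assms
  by (induction I rule: finite_induct) (auto intro: has_laplacian_const has_laplacian_add)

lemma iter_has_laplacian_add:
  assumes "(has_laplacian S ^^ p) f g" "(has_laplacian S ^^ p) f' g'"
  shows "(has_laplacian S ^^ p) (\<lambda>x. f x + f' x) (\<lambda>x. g x + g' x)"
  using assms
  by (induction p arbitrary: g g') (auto intro!: relcomppI has_laplacian_add)

lemma iter_has_laplacian_cmult:
  assumes "(has_laplacian S ^^ p) f g"
  shows "(has_laplacian S ^^ p) (\<lambda>x. c * f x) (\<lambda>x. c * g x)"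
  using assms
  by (induction p arbitrary: g) (auto intro!: relcomppI has_laplacian_cmult)

lemma iter_has_laplacian_zero: "(has_laplacian S ^^ p) (\<lambda>x. 0) (\<lambda>x. 0)"
  by (induction p) (auto intro!: relcomppI has_laplacian_const)

lemma iter_has_laplacian_const: "p > 0 \<Longrightarrow> (has_laplacian S ^^ p) (\<lambda>x. c) (\<lambda>x. 0)"
proof (induction p)
  case (Suc p)
  then show ?case
    by (cases "p = 0") (auto intro!: relcomppI has_laplacian_const)
qed simp

lemma iter_has_laplacian_sum:
  assumes "finite I" "\<And>i. i \<in> I \<Longrightarrow> (has_laplacian S ^^ p) (f i) (g i)"
  shows "(has_laplacian S ^^ p) (\<lambda>x. \<Sum>i\<in>I. f i x) (\<lambda>x. \<Sum>i\<in>I. g i x)"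
  using assms
  by (induction I rule: finite_induct) (auto intro: iter_has_laplacian_zero iter_has_laplacian_add)

section \<open>Series of functions with uniform local bounds on all derivatives\<close>

definition locally_equibounded :: "'a::metric_space set \<Rightarrow> (nat \<Rightarrow> 'a \<Rightarrow> real) \<Rightarrow> bool" where
  "locally_equibounded S g \<longleftrightarrow>
     (\<forall>x\<in>S. \<exists>r>0. \<exists>C. ball x r \<subseteq> S \<and> (\<forall>j. \<forall>y\<in>ball x r. \<bar>g j y\<bar> \<le> C))"

lemma locally_equibounded_add:
  assumes "locally_equibounded S g" "locally_equibounded S g'"
  shows "locally_equibounded S (\<lambda>j x. g j x + g' j x)"
  unfolding locally_equibounded_def
proof
  fix x assume "x \<in> S"
  then obtain r C r' C' where *: "r > 0" "ball x r \<subseteq> S" "\<And>j y. y \<in> ball x r \<Longrightarrow> \<bar>g j y\<bar> \<le> C"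
    "r' > 0" "\<And>j y. y \<in> ball x r' \<Longrightarrow> \<bar>g' j y\<bar> \<le> C'"
    using assms unfolding locally_equibounded_def by meson
  have "\<bar>g j y + g' j y\<bar> \<le> C + C'" if "y \<in> ball x (min r r')" for j y
    using *(3)[of y j] *(5)[of y j] that by auto
  with *(1,2,4) show "\<exists>r>0. \<exists>C. ball x r \<subseteq> S \<and> (\<forall>j. \<forall>y\<in>ball x r. \<bar>g j y + g' j y\<bar> \<le> C)"
    by (intro exI[of _ "min r r'"] exI[of _ "C + C'"] conjI) auto
qed

lemma locally_equibounded_mult:
  assumes "locally_equibounded S g" "locally_equibounded S g'"
  shows "locally_equibounded S (\<lambda>j x. g j x * g' j x)"
  unfolding locally_equibounded_def
proof
  fix x assume x: "x \<in> S"
  then obtain r C r' C' where *: "r > 0" "ball x r \<subseteq> S" "\<And>j y. y \<in> ball x r \<Longrightarrow> \<bar>g j y\<bar> \<le> C"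
    "r' > 0" "\<And>j y. y \<in> ball x r' \<Longrightarrow> \<bar>g' j y\<bar> \<le> C'"
    using assms unfolding locally_equibounded_def by meson
  have "\<bar>g j y * g' j y\<bar> \<le> C * C'" if "y \<in> ball x (min r r')" for j y
    unfolding abs_mult
    using *(3)[of y j] *(5)[of y j] that by (intro mult_mono) auto
  with *(1,2,4) show "\<exists>r>0. \<exists>C. ball x r \<subseteq> S \<and> (\<forall>j. \<forall>y\<in>ball x r. \<bar>g j y * g' j y\<bar> \<le> C)"
    by (intro exI[of _ "min r r'"] exI[of _ "C * C'"] conjI) auto
qed

lemma locally_equibounded_const: "open S \<Longrightarrow> locally_equibounded S (\<lambda>j x. c)"
  unfolding locally_equibounded_def by (meson open_contains_ball order_refl)

text \<open>The weights (1/2)^j are built into every series, so a bound uniform in \<open>j\<close>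
  already gives convergence.\<close>

lemma locally_equibounded_summable:
  assumes "locally_equibounded S g" "x \<in> S"
  shows "summable (\<lambda>j. (1/2)^j * g j x)"
proof -
  obtain r C where "r > 0" "\<And>j y. y \<in> ball x r \<Longrightarrow> \<bar>g j y\<bar> \<le> C"
    using assms unfolding locally_equibounded_def by meson
  then have "\<bar>g j x\<bar> \<le> C" for j by auto
  then have "norm ((1/2)^j * g j x) \<le> (1/2)^j * C" for j
    by (simp add: abs_mult power_divide divide_right_mono)
  moreover have "summable (\<lambda>j. (1/2::real)^j * C)"
    by (intro summable_mult2 summable_geometric) auto
  ultimately show ?thesis
    by (rule summable_comparison_test'[rotated])
qed

text \<open>Families whose partial derivatives of every order are bounded near each point, uniformly
  in the index. The greatest fixed point expresses "of every order" without multi-indices.\<close>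

coinductive equismooth :: "(real^'n::finite) set \<Rightarrow> (nat \<Rightarrow> real^'n \<Rightarrow> real) \<Rightarrow> bool" for S where
  "locally_equibounded S g \<Longrightarrow> (\<And>j. has_partials (g j) (\<lambda>i. D i j) S) \<Longrightarrow>
    (\<And>i. equismooth S (D i)) \<Longrightarrow> equismooth S g"

lemma equismooth_locally_equibounded: "equismooth S g \<Longrightarrow> locally_equibounded S g"
  by (auto elim: equismooth.cases)

lemma equismooth_partials:
  assumes "equismooth S g"
  obtains D where "\<And>j. has_partials (g j) (\<lambda>i. D i j) S" "\<And>i. equismooth S (D i)"
  using assms that by (cases rule: equismooth.cases) auto

lemma equismooth_add:
  assumes "equismooth S g" "equismooth S g'"
  shows "equismooth S (\<lambda>j x. g j x + g' j x)"
  using assms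
proof (coinduction arbitrary: g g')
  case equismooth
  obtain D D' where D: "\<And>j. has_partials (g j) (\<lambda>i. D i j) S" "\<And>i. equismooth S (D i)"
    "\<And>j. has_partials (g' j) (\<lambda>i. D' i j) S" "\<And>i. equismooth S (D' i)"
    using equismooth_partials[OF equismooth(1)] equismooth_partials[OF equismooth(2)] by metis
  have "has_partials (\<lambda>x. g j x + g' j x) (\<lambda>i x. D i j x + D' i j x) S" for j
    by (rule has_partials_add[OF D(1,3)])
  moreover have "locally_equibounded S (\<lambda>j x. g j x + g' j x)"
    by (intro locally_equibounded_add equismooth_locally_equibounded equismooth)
  moreover have "\<exists>h h'. (\<lambda>j x. D i j x + D' i j x) = (\<lambda>j x. h j x + h' j x) \<and>
      equismooth S h \<and> equismooth S h'" for i
    by (intro exI[of _ "D i"] exI[of _ "D' i"] conjI refl D)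
  ultimately show ?case
    by - (rule exI[of _ "\<lambda>j x. g j x + g' j x"], rule exI[of _ "\<lambda>i j x. D i j x + D' i j x"], simp)
qed

lemma equismooth_const:
  assumes "open S"
  shows "equismooth S (\<lambda>j x. c)"
proof (coinduction arbitrary: c)
  case equismooth
  then show ?case
    using locally_equibounded_const[OF assms] has_partials_const
    by (intro exI[of _ "\<lambda>j x. c"] exI[of _ "\<lambda>i j x. 0"]) auto
qed

lemma equismooth_sum:
  assumes "finite I" "open S" "\<And>i. i \<in> I \<Longrightarrow> equismooth S (g i)"
  shows "equismooth S (\<lambda>j x. \<Sum>i\<in>I. g i j x)"
  using assms(1,3)
  by (induction I rule: finite_induct) (auto intro: equismooth_const assms(2) equismooth_add)

text \<open>Termwise differentiation: the M-test with majorant (1/2)^j C gives uniform convergence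
  of the differentiated series on a ball, and \<open>has_derivative_series\<close> applies
  there.\<close>

lemma equismooth_series_has_partials:
  assumes g: "locally_equibounded S g" and D: "\<And>i. locally_equibounded S (D i)"
    and partials: "\<And>j. has_partials (g j) (\<lambda>i. D i j) S"
  shows "has_partials (\<lambda>x. \<Sum>j. (1/2)^j * g j x) (\<lambda>i x. \<Sum>j. (1/2)^j * D i j x) S"
  unfolding has_partials_def
proof
  fix x assume x: "x \<in> S"
  have "\<exists>r C. r > 0 \<and> ball x r \<subseteq> S \<and> (\<forall>j. \<forall>y\<in>ball x r. \<bar>D i j y\<bar> \<le> C)" for i
    using D[of i] x unfolding locally_equibounded_def by blast
  then obtain r C where r: "\<And>i. r i > 0" "\<And>i. ball x (r i) \<subseteq> S"
    "\<And>i j y. y \<in> ball x (r i) \<Longrightarrow> \<bar>D i j y\<bar> \<le> C i"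
    by metis
  \<comment> \<open>There are finitely many coordinates, so the least radius serves all of them; a
    ball supplies the convexity that \<open>has_derivative_series\<close> asks for.\<close>
  define B where "B = ball x (Min (range r))"
  have B: "x \<in> B" "open B" "convex B" "B \<subseteq> S" "\<And>i j y. y \<in> B \<Longrightarrow> \<bar>D i j y\<bar> \<le> C i"
  proof -
    have "B \<subseteq> ball x (r i)" for i
      unfolding B_def by (intro subset_ball Min_le) auto
    then show "B \<subseteq> S" "\<And>i j y. y \<in> B \<Longrightarrow> \<bar>D i j y\<bar> \<le> C i"
      using r by blast+
    show "x \<in> B" "open B" "convex B"
      using r(1) by (simp_all add: B_def)
  qed
  define D' where "D' = (\<lambda>i x. \<Sum>j. (1/2)^j * D i j x)"
  have uniform: "uniform_limit B (\<lambda>n x. \<Sum>j<n. (1/2)^j * D i j x) (D' i) sequentially" for i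
    unfolding D'_def
  proof (rule Weierstrass_m_test)
    show "norm ((1/2)^j * D i j y) \<le> (1/2)^j * C i" if "y \<in> B" for j y
      using B(5)[OF that, of i j] by (simp add: abs_mult power_divide divide_right_mono)
    show "summable (\<lambda>j. (1/2::real)^j * C i)"
      by (intro summable_mult2 summable_geometric) auto
  qed
  have "\<exists>G. \<forall>y\<in>B. (\<lambda>j. (1/2)^j * g j y) sums G y \<and>
      (G has_derivative (\<lambda>h. \<Sum>i\<in>UNIV. D' i y * h $ i)) (at y within B)"
  proof (rule has_derivative_series[OF B(3) _ _ B(1)])
    show "((\<lambda>x. (1/2)^j * g j x) has_derivative (\<lambda>h. \<Sum>i\<in>UNIV. ((1/2)^j * D i j y) * h $ i)) (at y within B)"
      if "y \<in> B" for j y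
      by (rule has_derivative_at_withinI)
        (use has_partials_cmult[OF partials, of "(1/2)^j" j] that B(4) in \<open>auto simp: has_partials_def\<close>)
    show "(\<lambda>j. (1/2)^j * g j x) sums (\<Sum>j. (1/2)^j * g j x)"
      using locally_equibounded_summable[OF g x] by (simp add: summable_sums)
    fix e :: real assume "e > 0"
    define e' where "e' = e / real CARD('a)"
    have "e' > 0" using \<open>e > 0\<close> by (simp add: e'_def)
    then have "\<forall>\<^sub>F n in sequentially. \<forall>i\<in>UNIV. \<forall>y\<in>B. dist (\<Sum>j<n. (1/2)^j * D i j y) (D' i y) < e'"
      by (intro eventually_ball_finite finite ballI uniform_limitD[OF uniform])
    then show "\<forall>\<^sub>F n in sequentially. \<forall>y\<in>B. \<forall>h. norm ((\<Sum>j<n. \<Sum>i\<in>UNIV. (1/2)^j * D i j y * h $ i) -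
        (\<Sum>i\<in>UNIV. D' i y * h $ i)) \<le> e * norm h"
    proof eventually_elim
      case (elim n)
      show ?case
      proof (intro ballI allI)
        fix y and h :: "real^'a" assume y: "y \<in> B"
        have "(\<Sum>j<n. \<Sum>i\<in>UNIV. (1/2)^j * D i j y * h $ i) - (\<Sum>i\<in>UNIV. D' i y * h $ i) =
          (\<Sum>i\<in>UNIV. ((\<Sum>j<n. (1/2)^j * D i j y) - D' i y) * h $ i)"
          by (subst sum.swap) (simp add: left_diff_distrib sum_subtractf sum_distrib_right)
        also have "norm \<dots> \<le> (\<Sum>i\<in>(UNIV::'a set). e' * norm h)"
        proof (rule sum_norm_le)
          fix i :: 'a
          have "\<bar>(\<Sum>j<n. (1/2)^j * D i j y) - D' i y\<bar> \<le> e'"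
            using elim[rule_format, of i y] y by (simp add: dist_real_def)
          then show "norm (((\<Sum>j<n. (1/2)^j * D i j y) - D' i y) * h $ i) \<le> e' * norm h"
            using component_le_norm_cart[of h i] \<open>e' > 0\<close> by (simp add: abs_mult mult_mono)
        qed
        also have "\<dots> = e * norm h"
          by (simp add: e'_def)
        finally show "norm ((\<Sum>j<n. \<Sum>i\<in>UNIV. (1/2)^j * D i j y * h $ i) -
          (\<Sum>i\<in>UNIV. D' i y * h $ i)) \<le> e * norm h" .
      qed
    qed
  qed
  then obtain G where "\<forall>y\<in>B. (\<lambda>j. (1/2)^j * g j y) sums G y \<and>
      (G has_derivative (\<lambda>h. \<Sum>i\<in>UNIV. D' i y * h $ i)) (at y within B)" ..
  then have G: "\<And>y. y \<in> B \<Longrightarrow> (\<lambda>j. (1/2)^j * g j y) sums G y"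
    "(G has_derivative (\<lambda>h. \<Sum>i\<in>UNIV. D' i x * h $ i)) (at x within B)"
    by (blast, blast intro: B(1))
  have "(G has_derivative (\<lambda>h. \<Sum>i\<in>UNIV. D' i x * h $ i)) (at x)"
    using G(2) unfolding at_within_open[OF B(1,2)] .
  then have "((\<lambda>x. \<Sum>j. (1/2)^j * g j x) has_derivative (\<lambda>h. \<Sum>i\<in>UNIV. D' i x * h $ i)) (at x)"
    by (rule has_derivative_transform_within_open[OF _ B(2,1)]) (use G(1) in \<open>auto simp: sums_iff\<close>)
  then show "((\<lambda>x. \<Sum>j. (1/2)^j * g j x) has_derivative
      (\<lambda>h. \<Sum>i\<in>UNIV. (\<Sum>j. (1/2)^j * D i j x) * h $ i)) (at x)"
    by (simp add: D'_def)
qed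

text \<open>Every iterated derivative of the series agrees on \<open>S\<close> with the series of
  another equismooth family: induction on the list of coordinates, each step differentiating
  termwise.\<close>

lemma equismooth_series_smooth_on:
  assumes "equismooth S g" "open S"
  shows "smooth_on (\<lambda>x. \<Sum>j. (1/2)^j * g j x) S"
proof -
  have *: "\<exists>g'. equismooth S g' \<and>
      (\<forall>x\<in>S. partial_derivs is (\<lambda>x. \<Sum>j. (1/2)^j * g j x) x = (\<Sum>j. (1/2)^j * g' j x))" for "is"
  proof (induction "is")
    case Nil
    then show ?case using assms(1) by auto
  next
    case (Cons i "is")
    then obtain g' where g': "equismooth S g'"
      "\<And>x. x \<in> S \<Longrightarrow> partial_derivs is (\<lambda>x. \<Sum>j. (1/2)^j * g j x) x = (\<Sum>j. (1/2)^j * g' j x)"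
      by auto
    obtain D where D: "\<And>j. has_partials (g' j) (\<lambda>i. D i j) S" "\<And>i. equismooth S (D i)"
      using equismooth_partials[OF g'(1)] by metis
    have "has_partials (\<lambda>x. \<Sum>j. (1/2)^j * g' j x) (\<lambda>i x. \<Sum>j. (1/2)^j * D i j x) S"
      by (intro equismooth_series_has_partials equismooth_locally_equibounded g'(1) D)
    then have "has_partials (partial_derivs is (\<lambda>x. \<Sum>j. (1/2)^j * g j x)) (\<lambda>i x. \<Sum>j. (1/2)^j * D i j x) S"
      by (rule has_partials_cong[OF _ assms(2) g'(2)])
    then have "\<forall>x\<in>S. partial_derivs (i # is) (\<lambda>x. \<Sum>j. (1/2)^j * g j x) x = (\<Sum>j. (1/2)^j * D i j x)"
      using has_partials_partial_deriv by auto
    with D(2) show ?case by blast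
  qed
  show ?thesis
    unfolding smooth_on_def
  proof (intro allI ballI)
    fix "is" x assume x: "x \<in> S"
    obtain g' where g': "equismooth S g'"
      "\<And>x. x \<in> S \<Longrightarrow> partial_derivs is (\<lambda>x. \<Sum>j. (1/2)^j * g j x) x = (\<Sum>j. (1/2)^j * g' j x)"
      using *[of "is"] by auto
    obtain D where D: "\<And>j. has_partials (g' j) (\<lambda>i. D i j) S" "\<And>i. equismooth S (D i)"
      using equismooth_partials[OF g'(1)] by metis
    have "has_partials (\<lambda>x. \<Sum>j. (1/2)^j * g' j x) (\<lambda>i x. \<Sum>j. (1/2)^j * D i j x) S"
      by (intro equismooth_series_has_partials equismooth_locally_equibounded g'(1) D)
    then have "has_partials (partial_derivs is (\<lambda>x. \<Sum>j. (1/2)^j * g j x)) (\<lambda>i x. \<Sum>j. (1/2)^j * D i j x) S"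
      by (rule has_partials_cong[OF _ assms(2) g'(2)])
    then show "partial_derivs is (\<lambda>x. \<Sum>j. (1/2)^j * g j x) differentiable at x"
      by (rule has_partials_differentiable[OF _ x])
  qed
qed

text \<open>The termwise Laplacians again form an equismooth family, so the exchange of sum and
  Laplacian can be repeated.\<close>

lemma equismooth_series_has_laplacian:
  assumes "equismooth S g" "open S"
  shows "\<exists>g'. equismooth S g' \<and> (\<forall>j. has_laplacian S (g j) (g' j)) \<and>
    has_laplacian S (\<lambda>x. \<Sum>j. (1/2)^j * g j x) (\<lambda>x. \<Sum>j. (1/2)^j * g' j x)"
proof -
  obtain D where D: "\<And>j. has_partials (g j) (\<lambda>i. D i j) S" "\<And>i. equismooth S (D i)"
    using equismooth_partials[OF assms(1)] by metis
  have "\<exists>E. (\<forall>j. has_partials (D i j) (\<lambda>k. E k j) S) \<and> (\<forall>k. equismooth S (E k))" for i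
    using equismooth_partials[OF D(2)] by metis
  then obtain E where E: "\<And>i j. has_partials (D i j) (\<lambda>k. E i k j) S" "\<And>i k. equismooth S (E i k)"
    by metis
  define g' where "g' = (\<lambda>j x. \<Sum>i\<in>UNIV. E i i j x)"
  note bounded = equismooth_locally_equibounded[OF assms(1)] equismooth_locally_equibounded[OF D(2)]
    equismooth_locally_equibounded[OF E(2)]
  show ?thesis
  proof (intro exI[of _ g'] conjI allI)
    show "equismooth S g'"
      unfolding g'_def by (intro equismooth_sum assms(2) E) auto
    show "has_laplacian S (g j) (g' j)" for j
      unfolding has_laplacian_def g'_def
      by (intro exI[of _ "\<lambda>i. D i j"] exI[of _ "\<lambda>i k. E i k j"]) (use D E in auto)
    have "(\<Sum>j. (1/2)^j * g' j x) = (\<Sum>i\<in>UNIV. \<Sum>j. (1/2)^j * E i i j x)" if "x \<in> S" for x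
      unfolding g'_def sum_distrib_left
      by (intro suminf_sum locally_equibounded_summable[OF bounded(3) that])
    then show "has_laplacian S (\<lambda>x. \<Sum>j. (1/2)^j * g j x) (\<lambda>x. \<Sum>j. (1/2)^j * g' j x)"
      unfolding has_laplacian_def
      by (intro exI[of _ "\<lambda>i x. \<Sum>j. (1/2)^j * D i j x"] exI[of _ "\<lambda>i k x. \<Sum>j. (1/2)^j * E i k j x"])
        (auto intro: equismooth_series_has_partials bounded D(1) E(1))
  qed
qed

lemma equismooth_series_iter_laplacian:
  assumes "equismooth S g" "open S" "x \<in> S"
  shows "(\<lambda>j. (1/2)^j * iter_laplacian p (g j) x) sums
    iter_laplacian p (\<lambda>x. \<Sum>j. (1/2)^j * g j x) x"
proof -
  have "\<exists>g'. equismooth S g' \<and> (\<forall>j. (has_laplacian S ^^ p) (g j) (g' j)) \<and>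
    (has_laplacian S ^^ p) (\<lambda>x. \<Sum>j. (1/2)^j * g j x) (\<lambda>x. \<Sum>j. (1/2)^j * g' j x)"
  proof (induction p)
    case 0
    then show ?case using assms(1) by auto
  next
    case (Suc p)
    then obtain h where h: "equismooth S h" "\<And>j. (has_laplacian S ^^ p) (g j) (h j)"
      "(has_laplacian S ^^ p) (\<lambda>x. \<Sum>j. (1/2)^j * g j x) (\<lambda>x. \<Sum>j. (1/2)^j * h j x)"
      by auto
    obtain g' where "equismooth S g'" "\<And>j. has_laplacian S (h j) (g' j)"
      "has_laplacian S (\<lambda>x. \<Sum>j. (1/2)^j * h j x) (\<lambda>x. \<Sum>j. (1/2)^j * g' j x)"
      using equismooth_series_has_laplacian[OF h(1) assms(2)] by blast
    with h show ?case
      by (intro exI[of _ g']) auto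
  qed
  then obtain g' where g': "equismooth S g'" "\<And>j. (has_laplacian S ^^ p) (g j) (g' j)"
    "(has_laplacian S ^^ p) (\<lambda>x. \<Sum>j. (1/2)^j * g j x) (\<lambda>x. \<Sum>j. (1/2)^j * g' j x)"
    by auto
  have "(\<lambda>j. (1/2)^j * g' j x) sums (\<Sum>j. (1/2)^j * g' j x)"
    by (intro summable_sums locally_equibounded_summable[OF equismooth_locally_equibounded[OF g'(1)] assms(3)])
  then show ?thesis
    using iter_has_laplacian[OF g'(2) assms(2,3)] iter_has_laplacian[OF g'(3) assms(2,3)] by simp
qed

text \<open>
  If every partial derivative of \<open>\<Phi> q\<close> is a coordinate times \<open>\<Phi> (Suc q)\<close>, this span is closed under
  partial differentiation, which is what the coinductive definition of \<open>equismooth\<close> asks for.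
\<close>

inductive_set chain_span :: "(nat \<Rightarrow> nat \<Rightarrow> real^'n::finite \<Rightarrow> real) \<Rightarrow> (nat \<Rightarrow> real^'n) \<Rightarrow>
    (nat \<Rightarrow> real^'n \<Rightarrow> real) set" for \<Phi> p where
  base: "\<Phi> q \<in> chain_span \<Phi> p"
| zero: "(\<lambda>j x. 0) \<in> chain_span \<Phi> p"
| add: "g \<in> chain_span \<Phi> p \<Longrightarrow> g' \<in> chain_span \<Phi> p \<Longrightarrow> (\<lambda>j x. g j x + g' j x) \<in> chain_span \<Phi> p"
| cmult: "g \<in> chain_span \<Phi> p \<Longrightarrow> (\<lambda>j x. c * g j x) \<in> chain_span \<Phi> p"
| coord: "g \<in> chain_span \<Phi> p \<Longrightarrow> (\<lambda>j x. (x $ i - p j $ i) * g j x) \<in> chain_span \<Phi> p"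

lemma chain_span_partials:
  assumes "\<And>q j. has_partials (\<Phi> q j) (\<lambda>i x. c * ((x $ i - p j $ i) * \<Phi> (Suc q) j x)) S"
    and "g \<in> chain_span \<Phi> p"
  shows "\<exists>D. (\<forall>j. has_partials (g j) (\<lambda>i. D i j) S) \<and> (\<forall>i. D i \<in> chain_span \<Phi> p)"
  using assms(2)
proof induction
  case (base q)
  show ?case
    by (intro exI[of _ "\<lambda>i j x. c * ((x $ i - p j $ i) * \<Phi> (Suc q) j x)"] conjI allI
        assms chain_span.intros)
next
  case zero
  then show ?case
    by (intro exI[of _ "\<lambda>i j x. 0"]) (auto intro: has_partials_const chain_span.intros)
next
  case (add g g')
  then obtain D D' where D: "\<And>j. has_partials (g j) (\<lambda>i. D i j) S" "\<And>i. D i \<in> chain_span \<Phi> p"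
    "\<And>j. has_partials (g' j) (\<lambda>i. D' i j) S" "\<And>i. D' i \<in> chain_span \<Phi> p" by metis
  then show ?case
    by (intro exI[of _ "\<lambda>i j x. D i j x + D' i j x"] conjI allI has_partials_add chain_span.intros)
next
  case (cmult g c)
  then obtain D where D: "\<And>j. has_partials (g j) (\<lambda>i. D i j) S" "\<And>i. D i \<in> chain_span \<Phi> p" by metis
  then show ?case
    by (intro exI[of _ "\<lambda>i j x. c * D i j x"] conjI allI has_partials_cmult chain_span.intros)
next
  case (coord g k)
  then obtain D where D: "\<And>j. has_partials (g j) (\<lambda>i. D i j) S" "\<And>i. D i \<in> chain_span \<Phi> p" by metis
  have "(\<lambda>j x. (if i = k then g j x else 0) + (x $ k - p j $ k) * D i j x) \<in> chain_span \<Phi> p" for i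
    using coord(1) chain_span.zero
    by (intro chain_span.add chain_span.coord D) (cases "i = k"; simp)
  with D show ?case
    by (intro exI[of _ "\<lambda>i j x. (if i = k then g j x else 0) + (x $ k - p j $ k) * D i j x"] conjI allI
        has_partials_coord_mult)
qed

text \<open>The centred coordinates are bounded near a point uniformly in \<open>j\<close> because
  the centres are bounded; sums and products preserve such bounds.\<close>

lemma chain_span_locally_equibounded:
  assumes "\<And>q. locally_equibounded S (\<Phi> q)" "bounded (range p)" "open S"
    and "g \<in> chain_span \<Phi> p"
  shows "locally_equibounded S g"
  using assms(4)
proof induction
  case (coord g i)
  obtain P where P: "\<And>j. norm (p j) \<le> P"
    using assms(2) unfolding bounded_iff by auto
  have "locally_equibounded S (\<lambda>j x. x $ i - p j $ i)"
    unfolding locally_equibounded_def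
  proof
    fix x assume "x \<in> S"
    then obtain r where r: "r > 0" "ball x r \<subseteq> S"
      using assms(3) by (meson open_contains_ball)
    have "\<bar>y $ i - p j $ i\<bar> \<le> norm x + r + P" if "y \<in> ball x r" for j y
      using component_le_norm_cart[of "y - p j" i] norm_triangle_ineq4[of y "p j"] P[of j]
        norm_triangle_ineq2[of y x] that by (simp add: dist_norm norm_minus_commute)
    with r show "\<exists>r>0. \<exists>C. ball x r \<subseteq> S \<and> (\<forall>j. \<forall>y\<in>ball x r. \<bar>y $ i - p j $ i\<bar> \<le> C)"
      by blast
  qed
  then show ?case
    using coord by (intro locally_equibounded_mult)
next
  case (cmult g c)
  then show ?case
    by (intro locally_equibounded_mult locally_equibounded_const assms(3))
qed (intro assms locally_equibounded_const locally_equibounded_add; assumption)+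

text \<open>\<open>chain_span\<close> is the coinduction invariant: it contains the family, consists
  of locally equibounded families, and is closed under differentiation.\<close>

lemma equismooth_chain:
  assumes "\<And>q j. has_partials (\<Phi> q j) (\<lambda>i x. c * ((x $ i - p j $ i) * \<Phi> (Suc q) j x)) S"
    and "\<And>q. locally_equibounded S (\<Phi> q)" "bounded (range p)" "open S"
  shows "equismooth S (\<Phi> q)"
proof -
  have "\<Phi> q \<in> chain_span \<Phi> p" by (rule chain_span.base)
  then show ?thesis
  proof (coinduct rule: equismooth.coinduct)
    case (equismooth g)
    then show ?case
      using chain_span_partials[of \<Phi> c p S g, OF assms(1)]
        chain_span_locally_equibounded[of S \<Phi> p g, OF assms(2-4)] by blast
  qed
qed

section \<open>Differences and Taylor remainders of the logarithm\<close>

text \<open>Up to sign the derivatives of \<open>- ln\<close>, normalised so that \<open>Lg q' = - Lg (Suc q)\<close> for every \<open>q\<close>.\<close>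

definition Lg :: "nat \<Rightarrow> real \<Rightarrow> real" where
  "Lg q s = (if q = 0 then - ln s else fact (q - 1) / s ^ q)"

lemma Lg_0: "Lg 0 s = - ln s" and Lg_Suc: "Lg (Suc q) s = fact q / s ^ Suc q"
  by (simp_all add: Lg_def)

lemma has_real_derivative_Lg:
  assumes "s > 0"
  shows "(Lg q has_real_derivative - Lg (Suc q) s) (at s)"
proof (cases q)
  case 0
  have "((\<lambda>s. - ln s) has_real_derivative - (1 / s)) (at s)"
    using assms by (auto intro!: derivative_eq_intros)
  then show ?thesis
    by (simp add: Lg_def[abs_def] 0)
next
  case (Suc r)
  have "((\<lambda>s. s ^ Suc r) has_real_derivative real (Suc r) * s ^ r) (at s)"
    using DERIV_pow[of "Suc r" s] by simp
  then have "((\<lambda>s. fact r * inverse (s ^ Suc r)) has_real_derivative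
      fact r * - (real (Suc r) * s ^ r * inverse ((s ^ Suc r)\<^sup>2))) (at s)"
    unfolding numeral_2_eq_2 by (intro DERIV_cmult DERIV_inverse_fun) (use assms in auto)
  also have "fact r * - (real (Suc r) * s ^ r * inverse ((s ^ Suc r)\<^sup>2)) = - (fact (Suc r) / s ^ Suc (Suc r))"
    using assms by (simp add: field_simps power2_eq_square)
  finally have "((\<lambda>s. fact r / s ^ Suc r) has_real_derivative - (fact (Suc r) / s ^ Suc (Suc r))) (at s)"
    by (simp add: divide_inverse)
  then show ?thesis
    by (simp add: Lg_def[abs_def] Suc)
qed

lemma Lg_pos: "q > 0 \<Longrightarrow> s > 0 \<Longrightarrow> Lg q s > 0"
  by (simp add: Lg_def)

lemma Lg_antimono: "0 < s \<Longrightarrow> s \<le> t \<Longrightarrow> Lg q t \<le> Lg q s"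
  by (auto simp: Lg_def intro!: divide_left_mono power_mono)

text \<open>Removes the factor |x - p|^2 from a Laplacian, once it is written as s - b.\<close>

lemma mult_Lg: "s > 0 \<Longrightarrow> s * Lg (Suc (Suc q)) s = (real q + 1) * Lg (Suc q) s"
  by (simp add: Lg_Suc field_simps)

text \<open>Carries the sign (-1)^p relative to the usual forward difference, so that it is
  nonnegative on completely monotone functions such as \<open>Lg q\<close> with q > 0.\<close>

fun step_diff :: "nat \<Rightarrow> real \<Rightarrow> (real \<Rightarrow> real) \<Rightarrow> real \<Rightarrow> real" where
  "step_diff 0 h f s = f s"
| "step_diff (Suc p) h f s = step_diff p h f s - step_diff p h f (s + h)"

lemma step_diff_eq_sum:
  "step_diff p h f s = (\<Sum>k\<le>p. (-1) ^ k * real (p choose k) * f (s + real k * h))"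
proof (induction p arbitrary: s)
  case (Suc p)
  have "(\<Sum>k\<le>Suc p. (-1) ^ k * real (Suc p choose k) * f (s + real k * h)) =
    f s + (\<Sum>k\<le>p. (-1) ^ Suc k * real (p choose Suc k) * f (s + real (Suc k) * h)) +
    (\<Sum>k\<le>p. (-1) ^ Suc k * real (p choose k) * f (s + real (Suc k) * h))"
    unfolding sum.atMost_Suc_shift add.assoc sum.distrib[symmetric]
    by (auto intro!: sum.cong simp: algebra_simps)
  also have "f s + (\<Sum>k\<le>p. (-1) ^ Suc k * real (p choose Suc k) * f (s + real (Suc k) * h)) =
    (\<Sum>k\<le>Suc p. (-1) ^ k * real (p choose k) * f (s + real k * h))"
    by (subst sum.atMost_Suc_shift) simp
  also have "\<dots> = step_diff p h f s"
    by (simp add: Suc.IH)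
  also have "(\<Sum>k\<le>p. (-1) ^ Suc k * real (p choose k) * f (s + real (Suc k) * h)) = - step_diff p h f (s + h)"
    unfolding Suc.IH by (simp add: algebra_simps sum_negf)
  finally show ?case by simp
qed simp

lemma has_real_derivative_step_diff_Lg:
  assumes "s > 0" "h \<ge> 0"
  shows "(step_diff p h (Lg q) has_real_derivative - step_diff p h (Lg (Suc q)) s) (at s)"
  using assms(1)
proof (induction p arbitrary: s)
  case 0
  then show ?case
    using has_real_derivative_Lg[of s q] by simp
next
  case (Suc p)
  have "((\<lambda>s. step_diff p h (Lg q) (s + h)) has_real_derivative - step_diff p h (Lg (Suc q)) (s + h)) (at s)"
    using Suc.IH[of "s + h"] Suc.prems assms(2) by (simp add: DERIV_shift)
  then show ?case
    using DERIV_diff[OF Suc.IH[OF Suc.prems]] by fastforce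
qed

text \<open>By the mean value theorem one difference is h times \<open>- f'\<close> at an
  intermediate point, and for \<open>Lg\<close> this is the function of the next index; p
  differences thus give h^p and raise the index by p. With p + q > 0 the final function is never the
  logarithm, whose sign changes.\<close>

lemma step_diff_Lg_bounds:
  assumes "s > 0" "h > 0" "p + q > 0"
  shows "0 \<le> step_diff p h (Lg q) s \<and> step_diff p h (Lg q) s \<le> h ^ p * Lg (q + p) s"
  using assms(1,3)
proof (induction p arbitrary: q s)
  case 0
  then show ?case
    using Lg_pos[of q s] by simp
next
  case (Suc p)
  obtain z where z: "z > s" "z < s + h" "step_diff p h (Lg q) (s + h) - step_diff p h (Lg q) s =
      (s + h - s) * - step_diff p h (Lg (Suc q)) z"
    using MVT2[of s "s + h" "step_diff p h (Lg q)" "\<lambda>x. - step_diff p h (Lg (Suc q)) x"]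
      has_real_derivative_step_diff_Lg[of _ h p q] assms(2) Suc.prems(1) by force
  have eq: "step_diff (Suc p) h (Lg q) s = h * step_diff p h (Lg (Suc q)) z"
    using z(3) by simp
  have IH: "0 \<le> step_diff p h (Lg (Suc q)) z" "step_diff p h (Lg (Suc q)) z \<le> h ^ p * Lg (Suc q + p) z"
    using Suc.IH[of z "Suc q"] z Suc.prems by auto
  note IH(2)
  also have "\<dots> \<le> h ^ p * Lg (Suc q + p) s"
    using z Suc.prems assms(2) by (intro mult_left_mono Lg_antimono) auto
  finally have "step_diff p h (Lg (Suc q)) z \<le> h ^ p * Lg (Suc q + p) s" .
  then show ?case
    unfolding eq using assms(2) IH(1) by (simp add: mult_left_mono mult.assoc)
qed

text \<open>The Taylor remainder of order \<open>p\<close> in \<open>h\<close> at h = 0: the k-th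
  derivative of \<open>Lg q\<close> is (-1)^k \<open>Lg (q + k)\<close>.\<close>

definition Lg_remainder :: "nat \<Rightarrow> real \<Rightarrow> nat \<Rightarrow> real \<Rightarrow> real" where
  "Lg_remainder p h q s = Lg q (s + h) - (\<Sum>k<p. (- h) ^ k / fact k * Lg (q + k) s)"

lemma has_real_derivative_Lg_remainder:
  assumes "s > 0" "h \<ge> 0"
  shows "(Lg_remainder p h q has_real_derivative - Lg_remainder p h (Suc q) s) (at s)"
proof -
  have "((\<lambda>s. Lg q (s + h)) has_real_derivative - Lg (Suc q) (s + h)) (at s)"
    using has_real_derivative_Lg[of "s + h" q] assms by (simp add: DERIV_shift)
  moreover have "((\<lambda>s. \<Sum>k<p. (- h) ^ k / fact k * Lg (q + k) s) has_real_derivative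
      (\<Sum>k<p. (- h) ^ k / fact k * - Lg (Suc (q + k)) s)) (at s)"
    using assms(1) by (intro DERIV_sum DERIV_cmult has_real_derivative_Lg)
  ultimately have "((\<lambda>s. Lg q (s + h) - (\<Sum>k<p. (- h) ^ k / fact k * Lg (q + k) s)) has_real_derivative
     - Lg (Suc q) (s + h) - (\<Sum>k<p. (- h) ^ k / fact k * - Lg (Suc (q + k)) s)) (at s)"
    by (rule DERIV_diff)
  then show ?thesis
    by (simp add: Lg_remainder_def[abs_def] sum_negf)
qed

text \<open>Differentiating in the increment lowers the order and raises the index, which drives the
  induction for the remainder bound.\<close>

lemma has_real_derivative_Lg_remainder_increment:
  assumes "s > 0" "h \<ge> 0"
  shows "((\<lambda>h. Lg_remainder (Suc p) h q s) has_real_derivative - Lg_remainder p h (Suc q) s) (at h)"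
proof -
  have "((\<lambda>h. Lg q (s + h)) has_real_derivative - Lg (Suc q) (s + h)) (at h)"
    using has_real_derivative_Lg[of "s + h" q] assms by (subst add.commute) (simp add: DERIV_shift add.commute)
  moreover have "((\<lambda>h. \<Sum>k<p. (- h) ^ Suc k / fact (Suc k) * Lg (q + Suc k) s) has_real_derivative
      (\<Sum>k<p. - ((- h) ^ k / fact k * Lg (Suc q + k) s))) (at h)"
  proof (rule DERIV_sum)
    fix k
    have "((\<lambda>h. (- h) ^ Suc k / fact (Suc k) * Lg (q + Suc k) s) has_real_derivative
      ((real (Suc k) * (- h) ^ k * - 1) / fact (Suc k)) * Lg (q + Suc k) s) (at h)"
      by (auto intro!: derivative_eq_intros simp del: power_Suc fact_Suc)
    also have "((real (Suc k) * (- h) ^ k * - 1) / fact (Suc k)) = - ((- h) ^ k / fact k)"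
      by (simp add: fact_Suc del: of_nat_Suc)
    finally show "((\<lambda>h. (- h) ^ Suc k / fact (Suc k) * Lg (q + Suc k) s) has_real_derivative
      - ((- h) ^ k / fact k * Lg (Suc q + k) s)) (at h)"
      by simp
  qed
  ultimately have "((\<lambda>h. Lg q (s + h) - (Lg q s + (\<Sum>k<p. (- h) ^ Suc k / fact (Suc k) * Lg (q + Suc k) s)))
      has_real_derivative - Lg (Suc q) (s + h) - (0 + (\<Sum>k<p. - ((- h) ^ k / fact k * Lg (Suc q + k) s)))) (at h)"
    by (intro DERIV_diff DERIV_add DERIV_const)
  then show ?thesis
    unfolding Lg_remainder_def sum.lessThan_Suc_shift by (simp add: sum_negf)
qed

text \<open>Induction on the order by the mean value theorem in \<open>h\<close>, starting from the
  zero of the remainder at h = 0. At order 0 the claim is positivity and monotonicity of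
  \<open>Lg q\<close>.\<close>

lemma abs_Lg_remainder_le:
  assumes "s > 0" "h \<ge> 0" "p + q > 0"
  shows "\<bar>Lg_remainder p h q s\<bar> \<le> h ^ p * Lg (q + p) s"
  using assms(2,3)
proof (induction p arbitrary: q h)
  case 0
  then show ?case
    using Lg_antimono[of s "s + h" q] Lg_pos[of q "s + h"] assms(1) by (simp add: Lg_remainder_def)
next
  case (Suc p)
  have zero: "Lg_remainder (Suc p) 0 q s = 0"
    unfolding Lg_remainder_def sum.lessThan_Suc_shift by simp
  show ?case
  proof (cases "h = 0")
    case True
    then show ?thesis using zero by simp
  next
    case False
    then obtain z where z: "z > 0" "z < h"
      "Lg_remainder (Suc p) h q s - Lg_remainder (Suc p) 0 q s = (h - 0) * - Lg_remainder p z (Suc q) s"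
      using MVT2[of 0 h "\<lambda>h. Lg_remainder (Suc p) h q s" "\<lambda>h. - Lg_remainder p h (Suc q) s"]
        has_real_derivative_Lg_remainder_increment[of s _ p q] assms(1) Suc.prems(1) by force
    have "\<bar>Lg_remainder p z (Suc q) s\<bar> \<le> z ^ p * Lg (Suc q + p) s"
      using z by (intro Suc.IH) auto
    also have "\<dots> \<le> h ^ p * Lg (Suc q + p) s"
      using z Lg_pos[of "Suc q + p" s] assms(1) by (intro mult_right_mono power_mono) auto
    finally show ?thesis
      using z(3) Suc.prems(1) by (simp add: zero abs_mult mult_left_mono mult.assoc)
  qed
qed

section \<open>Iterated Laplacians of logarithmic bubbles\<close>

lemma has_partials_Lg:
  fixes p :: "real^'n::finite"
  assumes "\<And>x. x \<in> S \<Longrightarrow> norm (x - p) ^ 2 + b > 0"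
  shows "has_partials (\<lambda>x. Lg q (norm (x - p) ^ 2 + b))
    (\<lambda>i x. - 2 * ((x $ i - p $ i) * Lg (Suc q) (norm (x - p) ^ 2 + b))) S"
  using has_partials_radial[of S "Lg q" "\<lambda>s. - Lg (Suc q) s" p b] has_real_derivative_Lg assms
  by simp

text \<open>In dimension 2m the Laplacian of F(|x - p|^2 + b) is 4 r F'' + 4 m F' with r = |x -
  p|^2. Here F' and F'' are - \<open>Lg (Suc q)\<close> and \<open>Lg (Suc (Suc q))\<close>, and
  \<open>mult_Lg\<close> eliminates r = s - b.\<close>

lemma has_laplacian_Lg:
  fixes p :: "real^'n::finite"
  assumes card: "CARD('n) = 2 * m" and pos: "\<And>x. x \<in> S \<Longrightarrow> norm (x - p) ^ 2 + b > 0"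
  shows "has_laplacian S (\<lambda>x. Lg q (norm (x - p) ^ 2 + b))
    (\<lambda>x. 4 * (real q + 1 - real m) * Lg (Suc q) (norm (x - p) ^ 2 + b) -
      4 * b * Lg (Suc (Suc q)) (norm (x - p) ^ 2 + b))"
  unfolding has_laplacian_def
proof (intro exI conjI allI ballI)
  show "has_partials (\<lambda>x. Lg q (norm (x - p) ^ 2 + b))
    (\<lambda>i x. - 2 * ((x $ i - p $ i) * Lg (Suc q) (norm (x - p) ^ 2 + b))) S"
    by (rule has_partials_Lg[OF pos])
  show "has_partials (\<lambda>x. - 2 * ((x $ i - p $ i) * Lg (Suc q) (norm (x - p) ^ 2 + b)))
    (\<lambda>k x. - 2 * ((if k = i then Lg (Suc q) (norm (x - p) ^ 2 + b) else 0) +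
      (x $ i - p $ i) * (- 2 * ((x $ k - p $ k) * Lg (Suc (Suc q)) (norm (x - p) ^ 2 + b))))) S" for i
    by (intro has_partials_cmult has_partials_coord_mult has_partials_Lg[OF pos])
  fix x assume x: "x \<in> S"
  define r where "r = norm (x - p) ^ 2"
  have r: "(\<Sum>i\<in>UNIV. (x $ i - p $ i) ^ 2) = r"
    unfolding r_def power2_norm_eq_inner inner_vec_def by (simp add: power2_eq_square)
  have rec: "(r + b) * Lg (Suc (Suc q)) (r + b) = (real q + 1) * Lg (Suc q) (r + b)"
    using pos[OF x] by (intro mult_Lg) (simp add: r_def)
  have "(\<Sum>i\<in>UNIV. - 2 * ((if i = i then Lg (Suc q) (r + b) else 0) +
      (x $ i - p $ i) * (- 2 * ((x $ i - p $ i) * Lg (Suc (Suc q)) (r + b))))) =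
    (\<Sum>i\<in>(UNIV::'n set). - 2 * Lg (Suc q) (r + b)) + 4 * Lg (Suc (Suc q)) (r + b) * (\<Sum>i\<in>UNIV. (x $ i - p $ i) ^ 2)"
    unfolding sum_distrib_left sum.distrib[symmetric]
    by (intro sum.cong) (auto simp: algebra_simps power2_eq_square)
  also have "\<dots> = - 4 * real m * Lg (Suc q) (r + b) + 4 * r * Lg (Suc (Suc q)) (r + b)"
    by (simp add: r card)
  also have "\<dots> = 4 * (real q + 1 - real m) * Lg (Suc q) (r + b) - 4 * b * Lg (Suc (Suc q)) (r + b)"
    using rec by (simp add: algebra_simps)
  finally show "4 * (real q + 1 - real m) * Lg (Suc q) (norm (x - p) ^ 2 + b) -
      4 * b * Lg (Suc (Suc q)) (norm (x - p) ^ 2 + b) =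
    (\<Sum>i\<in>UNIV. - 2 * ((if i = i then Lg (Suc q) (norm (x - p) ^ 2 + b) else 0) +
      (x $ i - p $ i) * (- 2 * ((x $ i - p $ i) * Lg (Suc (Suc q)) (norm (x - p) ^ 2 + b)))))"
    by (simp add: r_def)
qed

lemma iter_has_laplacian_Lg_centre:
  fixes S :: "(real^'n::finite) set"
  assumes card: "CARD('n) = 2 * m" and S: "0 \<notin> S"
  shows "(has_laplacian S ^^ k) (\<lambda>x. Lg q (norm x ^ 2))
    (\<lambda>x. 4 ^ k * (\<Prod>l<k. real q + 1 + real l - real m) * Lg (q + k) (norm x ^ 2))"
proof (induction k)
  case (Suc k)
  have "has_laplacian S (\<lambda>x. Lg (q + k) (norm x ^ 2))
    (\<lambda>x. 4 * (real (q + k) + 1 - real m) * Lg (Suc (q + k)) (norm x ^ 2))"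
    using has_laplacian_Lg[OF card, of S 0 0 "q + k"] S by auto
  from has_laplacian_cmult[OF this, of "4 ^ k * (\<Prod>l<k. real q + 1 + real l - real m)"]
  show ?case
    by (intro iter_has_laplacian_Suc[OF Suc]) (simp add: algebra_simps)
qed simp

text \<open>The logarithm and the powers |x|^(-2q) with 0 < q < m are polyharmonic off the origin:
  the factor with l = m - 1 - q vanishes.\<close>

lemma iter_has_laplacian_Lg_centre_zero:
  fixes S :: "(real^'n::finite) set"
  assumes card: "CARD('n) = 2 * m" and S: "0 \<notin> S" and q: "q < m"
  shows "(has_laplacian S ^^ m) (\<lambda>x. Lg q (norm x ^ 2)) (\<lambda>x. 0)"
proof -
  have "(\<Prod>l<m. real q + 1 + real l - real m) = 0"
    using q by (intro prod_zero) (auto intro!: bexI[of _ "m - 1 - q"] simp: of_nat_diff)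
  then show ?thesis
    using iter_has_laplacian_Lg_centre[OF card S, of m q] by (simp only: mult_zero_left mult_zero_right)
qed

text \<open>
  The coefficients of \<open>(-\<Delta>/4)\<^sup>k\<close> applied to \<open>Lg 0\<close>; for \<open>k = m\<close> the factor \<open>l = m\<close> kills all but the top one.
\<close>

definition bubble_coeff :: "nat \<Rightarrow> nat \<Rightarrow> nat \<Rightarrow> real" where
  "bubble_coeff m k i = real (k choose i) * (\<Prod>l\<in>{i<..k}. real m - real l)"

lemma bubble_coeff_Suc_0: "bubble_coeff m (Suc k) 0 = (real m - real k - 1) * bubble_coeff m k 0"
proof -
  have "{0<..Suc k} = insert (Suc k) {0<..k}" by auto
  then show ?thesis by (simp add: bubble_coeff_def)
qed

text \<open>The recurrence forced by \<open>has_laplacian_Lg\<close> at index k + i: one term keeps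
  the power of b, the other raises it. It reduces to Pascal's rule and (i + 1) C(k, i + 1) = (k - i)
  C(k, i).\<close>

lemma bubble_coeff_Suc_Suc:
  "bubble_coeff m (Suc k) (Suc i) =
    (real m - real k - real (Suc i) - 1) * bubble_coeff m k (Suc i) + bubble_coeff m k i"
proof -
  consider "i < k" | "i = k" | "i > k" by linarith
  then show ?thesis
  proof cases
    case 1
    define P where "P = (\<Prod>l\<in>{Suc i<..k}. real m - real l)"
    have "{Suc i<..Suc k} = insert (Suc k) {Suc i<..k}" "{i<..k} = insert (Suc i) {Suc i<..k}"
      using 1 by auto
    then have *: "(\<Prod>l\<in>{Suc i<..Suc k}. real m - real l) = (real m - real k - 1) * P"
      "(\<Prod>l\<in>{i<..k}. real m - real l) = (real m - real i - 1) * P"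
      by (simp_all add: P_def)
    have "real (Suc i) * real (k choose Suc i) = real (k - i) * real (k choose i)"
      by (simp only: binomial_absorb_comp flip: of_nat_mult) (metis binomial_absorb_comp binomial_absorption)
    then have absorb: "(real i + 1) * real (k choose Suc i) = (real k - real i) * real (k choose i)"
      using 1 by (simp add: of_nat_diff add.commute)
    have "(real (k choose i) + real (k choose Suc i)) * (real m - real k - 1) =
      (real m - real k - real (Suc i) - 1) * real (k choose Suc i) + real (k choose i) * (real m - real i - 1)"
      using absorb by (simp add: algebra_simps)
    then have "real (Suc k choose Suc i) * ((real m - real k - 1) * P) =
      ((real m - real k - real (Suc i) - 1) * real (k choose Suc i) + real (k choose i) * (real m - real i - 1)) * P"
      by simp
    then show ?thesis
      unfolding bubble_coeff_def * P_def[symmetric] by (simp add: algebra_simps)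
  qed (simp_all add: bubble_coeff_def)
qed

lemma iter_has_laplacian_bubble_aux:
  fixes p :: "real^'n::finite"
  assumes card: "CARD('n) = 2 * m" and pos: "\<And>x. x \<in> S \<Longrightarrow> norm (x - p) ^ 2 + b > 0"
  shows "(has_laplacian S ^^ k) (\<lambda>x. Lg 0 (norm (x - p) ^ 2 + b))
    (\<lambda>x. (- 4) ^ k * (\<Sum>i\<le>k. bubble_coeff m k i * b ^ i * Lg (k + i) (norm (x - p) ^ 2 + b)))"
proof (induction k)
  case 0
  then show ?case by (simp add: bubble_coeff_def)
next
  case (Suc k)
  define G where "G = (\<lambda>x i. Lg (Suc k + i) (norm (x - p) ^ 2 + b))"
  have "has_laplacian S (\<lambda>x. Lg (k + i) (norm (x - p) ^ 2 + b))
      (\<lambda>x. 4 * (real (k + i) + 1 - real m) * G x i - 4 * b * G x (Suc i))" for i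
    using has_laplacian_Lg[OF card pos, of S "k + i"] by (simp add: G_def)
  then have "has_laplacian S
      (\<lambda>x. (- 4) ^ k * (\<Sum>i\<le>k. bubble_coeff m k i * b ^ i * Lg (k + i) (norm (x - p) ^ 2 + b)))
      (\<lambda>x. (- 4) ^ k * (\<Sum>i\<le>k. bubble_coeff m k i * b ^ i *
        (4 * (real (k + i) + 1 - real m) * G x i - 4 * b * G x (Suc i))))"
    by (intro has_laplacian_cmult has_laplacian_sum finite_atMost)
  moreover have "(- 4) ^ k * (\<Sum>i\<le>k. bubble_coeff m k i * b ^ i *
        (4 * (real (k + i) + 1 - real m) * G x i - 4 * b * G x (Suc i))) =
      (- 4) ^ Suc k * (\<Sum>i\<le>Suc k. bubble_coeff m (Suc k) i * b ^ i * G x i)" for x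
  proof -
    \<comment> \<open>\<open>T\<close> collects the terms that keep the power of b. Its coefficient
      at k + 1 is zero, so its sum may be extended by one and reindexed to line up with the terms
      that raise the power.\<close>
    define T where "T = (\<lambda>i. (real m - real k - real i - 1) * bubble_coeff m k i * b ^ i * G x i)"
    have "bubble_coeff m k (Suc k) = 0" by (simp add: bubble_coeff_def)
    then have "(\<Sum>i\<le>k. T i) = (\<Sum>i\<le>Suc k. T i)"
      by (simp add: T_def)
    also have "\<dots> = T 0 + (\<Sum>i\<le>k. T (Suc i))"
      by (rule sum.atMost_Suc_shift)
    finally have T: "(\<Sum>i\<le>k. T i) = T 0 + (\<Sum>i\<le>k. T (Suc i))" .
    have "(\<Sum>i\<le>Suc k. bubble_coeff m (Suc k) i * b ^ i * G x i) =
      T 0 + (\<Sum>i\<le>k. T (Suc i) + bubble_coeff m k i * b ^ Suc i * G x (Suc i))"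
      unfolding sum.atMost_Suc_shift bubble_coeff_Suc_0 bubble_coeff_Suc_Suc T_def
      by (simp add: algebra_simps)
    also have "\<dots> = (\<Sum>i\<le>k. T i + bubble_coeff m k i * b ^ Suc i * G x (Suc i))"
      by (simp add: T sum.distrib)
    finally have "(- 4) * (\<Sum>i\<le>Suc k. bubble_coeff m (Suc k) i * b ^ i * G x i) =
      (\<Sum>i\<le>k. - 4 * (T i + bubble_coeff m k i * b ^ Suc i * G x (Suc i)))"
      by (simp add: sum_distrib_left)
    also have "\<dots> = (\<Sum>i\<le>k. bubble_coeff m k i * b ^ i *
        (4 * (real (k + i) + 1 - real m) * G x i - 4 * b * G x (Suc i)))"
      by (intro sum.cong refl) (simp add: T_def algebra_simps)
    finally show ?thesis by (simp only: power_Suc2 mult.assoc)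
  qed
  ultimately show ?case
    using Suc by (auto simp: G_def)
qed

text \<open>At k = m every coefficient but the top one vanishes, leaving a single multiple of (b /
  s^2)^m with s = |x - p|^2 + b.\<close>

lemma iter_has_laplacian_bubble:
  fixes p :: "real^'n::finite"
  assumes card: "CARD('n) = 2 * m" and pos: "\<And>x. x \<in> S \<Longrightarrow> norm (x - p) ^ 2 + b > 0"
  shows "(has_laplacian S ^^ m) (\<lambda>x. Lg 0 (norm (x - p) ^ 2 + b))
    (\<lambda>x. (- 4) ^ m * b ^ m * Lg (2 * m) (norm (x - p) ^ 2 + b))"
proof -
  have "bubble_coeff m m i = (if i = m then 1 else 0)" if "i \<le> m" for i
    using that by (auto simp: bubble_coeff_def)
  then have "(\<Sum>i\<le>m. bubble_coeff m m i * b ^ i * Lg (m + i) s) = 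
      (\<Sum>i\<le>m. if i = m then b ^ i * Lg (m + i) s else 0)" for s
    by (intro sum.cong) auto
  also have "\<dots> s = b ^ m * Lg (2 * m) s" for s
    by (simp add: mult_2)
  finally show ?thesis
    using iter_has_laplacian_bubble_aux[OF card pos, of S m] by (simp add: mult.assoc)
qed

section \<open>The spike profile\<close>

text \<open>Spike, compensator and base. After m Laplacians the \<open>B\<close> term becomes a
  bubble at the origin, meant to outweigh the wrong-signed bubbles of the spike. The
  \<open>K\<close> term is annihilated by the m-th Laplacian and is there for positivity; for m
  \<ge> 2, \<open>Lg (m - 1)\<close> gives a multiple of |x|^(-(2m-2)).\<close>

definition profile :: "nat \<Rightarrow> real \<Rightarrow> real \<Rightarrow> real \<Rightarrow> real^'n::finite \<Rightarrow> real^'n \<Rightarrow> real" where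
  "profile m B K b p x = (1 / norm p ^ (2 * m - 2)) *
     (step_diff m (norm p ^ 2) (Lg 0) (norm (x - p) ^ 2 + b) +
       B * Lg_remainder m (norm p ^ 2) 0 (norm x ^ 2)) +
     K * (Lg (m - 1) (norm x ^ 2) + 1)"

text \<open>Only the bubbles survive m Laplacians; all remaining terms are polyharmonic off the
  origin. As m is odd, (-4)^m = - 4^m, whence the sign on the left.\<close>

lemma iter_laplacian_profile:
  fixes p :: "real^'n::finite"
  assumes card: "CARD('n) = 2 * m" and m: "odd m" "m \<ge> 2" and b: "b > 0" and x: "x \<noteq> 0"
  shows "- iter_laplacian m (profile m B K b p) x = 4 ^ m * (1 / norm p ^ (2 * m - 2)) *
    ((\<Sum>k\<le>m. (-1) ^ k * real (m choose k) * ((b + real k * norm p ^ 2) ^ m *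
        Lg (2 * m) (norm (x - p) ^ 2 + (b + real k * norm p ^ 2)))) +
      B * ((norm p ^ 2) ^ m * Lg (2 * m) (norm x ^ 2 + norm p ^ 2)))"
proof -
  let ?S = "- {0 :: real^'n}"
  define h w where "h = norm p ^ 2" and "w = 1 / norm p ^ (2 * m - 2)"
  let ?F = "\<lambda>k x. ((-1) ^ k * real (m choose k)) *
    ((- 4) ^ m * (b + real k * h) ^ m * Lg (2 * m) (norm (x - p) ^ 2 + (b + real k * h)))"
  have h: "h \<ge> 0" by (simp add: h_def)
  have "norm (x - p) ^ 2 + (b + real k * h) > 0" for k and x :: "real^'n"
    using b h by (intro add_nonneg_pos add_pos_nonneg) auto
  then have spike: "(has_laplacian ?S ^^ m) (\<lambda>x. Lg 0 (norm (x - p) ^ 2 + (b + real k * h)))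
    (\<lambda>x. (- 4) ^ m * (b + real k * h) ^ m * Lg (2 * m) (norm (x - p) ^ 2 + (b + real k * h)))" for k
    by (rule iter_has_laplacian_bubble[OF card])
  have "(has_laplacian ?S ^^ m)
    (\<lambda>x. \<Sum>k\<le>m. ((-1) ^ k * real (m choose k)) * Lg 0 (norm (x - p) ^ 2 + (b + real k * h)))
    (\<lambda>x. \<Sum>k\<le>m. ?F k x)"
    by (intro iter_has_laplacian_sum iter_has_laplacian_cmult finite_atMost spike)
  then have step: "(has_laplacian ?S ^^ m) (\<lambda>x. step_diff m h (Lg 0) (norm (x - p) ^ 2 + b))
    (\<lambda>x. \<Sum>k\<le>m. ?F k x)"
    unfolding step_diff_eq_sum by (simp only: add.assoc)
  have "norm (x - 0) ^ 2 + h > 0" if "x \<in> ?S" for x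
    using that h by (intro add_pos_nonneg) auto
  then have bubble: "(has_laplacian ?S ^^ m) (\<lambda>x. Lg 0 (norm x ^ 2 + h))
      (\<lambda>x. (- 4) ^ m * h ^ m * Lg (2 * m) (norm x ^ 2 + h))"
    using iter_has_laplacian_bubble[OF card, of ?S 0 h] by simp
  have centre: "(has_laplacian ?S ^^ m) (\<lambda>x. Lg q (norm x ^ 2)) (\<lambda>x. 0)" if "q < m" for q
    by (rule iter_has_laplacian_Lg_centre_zero[OF card _ that]) simp
  have "(has_laplacian ?S ^^ m)
      (\<lambda>x. Lg 0 (norm x ^ 2 + h) + (- 1) * (\<Sum>k<m. (- h) ^ k / fact k * Lg (0 + k) (norm x ^ 2)))
      (\<lambda>x. (- 4) ^ m * h ^ m * Lg (2 * m) (norm x ^ 2 + h) + (- 1) * (\<Sum>k<m. (- h) ^ k / fact k * 0))"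
    by (intro iter_has_laplacian_add iter_has_laplacian_cmult iter_has_laplacian_sum bubble centre) auto
  then have rem: "(has_laplacian ?S ^^ m) (\<lambda>x. Lg_remainder m h 0 (norm x ^ 2))
      (\<lambda>x. (- 4) ^ m * h ^ m * Lg (2 * m) (norm x ^ 2 + h))"
    by (simp add: Lg_remainder_def)
  have "(has_laplacian ?S ^^ m) (profile m B K b p)
     (\<lambda>x. w * ((\<Sum>k\<le>m. ?F k x)
       + B * ((- 4) ^ m * h ^ m * Lg (2 * m) (norm x ^ 2 + h))) + K * (0 + 0))"
    unfolding profile_def[abs_def] h_def[symmetric] w_def[symmetric]
    using m(2)
    by (intro iter_has_laplacian_add iter_has_laplacian_cmult step rem centre iter_has_laplacian_const) auto
  from iter_has_laplacian[OF this, of x]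
  have "iter_laplacian m (profile m B K b p) x =
    w * ((\<Sum>k\<le>m. ?F k x)
       + B * ((- 4) ^ m * h ^ m * Lg (2 * m) (norm x ^ 2 + h)))"
    using x by (simp add: open_Compl)
  also have "(- 4) ^ m = - (4 ^ m :: real)"
    using m(1) by simp
  finally show ?thesis
    unfolding h_def[symmetric] w_def[symmetric]
    by (simp add: sum_distrib_left sum_negf algebra_simps)
qed

text \<open>For r \<ge> 1 the constant dominates, for r < 1 the larger exponent does. This brings
  every decay rate to the common form r^(-\<kappa>) + 1.\<close>

lemma inverse_power_le_powr:
  assumes "0 < r" "0 \<le> \<kappa>" "real n \<le> \<kappa>"
  shows "1 / r ^ n \<le> r powr - \<kappa> + (1::real)"
proof (cases "r \<ge> 1")
  case True
  then have "1 / r ^ n \<le> 1"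
    by (simp add: divide_le_eq_1)
  then show ?thesis
    using powr_ge_zero[of r "- \<kappa>"] by linarith
next
  case False
  have "1 / r ^ n = r powr - real n"
    using assms(1) by (simp add: powr_minus powr_realpow inverse_eq_divide)
  also have "\<dots> \<le> r powr - \<kappa>"
    using False assms by (intro powr_mono') auto
  finally show ?thesis by simp
qed

text \<open>Of the bubbles in the difference only the one with k = 0 can be tall; its weighted peak
  is a multiple of |p|^(-\<kappa>) by the third condition on \<open>b\<close>. The others have width
  comparable to |p|, so the bubble at the origin controls them up to the factor
  \<open>B\<close>.\<close>

lemma profile_laplacian_bounds:
  fixes p x :: "real^'n::finite"
  assumes card: "CARD('n) = 2 * m" and m: "odd m" "m \<ge> 2" and p: "p \<noteq> 0" and x: "x \<noteq> 0"
    and b: "0 < b" "b \<le> norm p ^ 2" "1 / (norm p ^ (2 * m - 2) * b ^ m) = norm p powr - \<kappa>"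
    and \<kappa>: "4 * real m - 2 \<le> \<kappa>"
    and B: "B = (18 * (real m + 1)) ^ m"
  shows "0 \<le> - iter_laplacian m (profile m B K b p) x"
    and "- iter_laplacian m (profile m B K b p) x \<le>
      4 ^ m * fact (2 * m - 1) * (2 powr \<kappa> + 16 ^ m + 2 * B) * (norm x powr - \<kappa> + 1)"
proof -
  define h w s t where "h = norm p ^ 2" and "w = 1 / norm p ^ (2 * m - 2)"
    and "s = norm (x - p) ^ 2" and "t = norm x ^ 2"
  have pos: "h > 0" "w > 0" "t > 0" "s \<ge> 0" "norm p > 0" "norm x > 0" "B > 0" "b \<le> h"
    using p x b by (auto simp: h_def w_def s_def t_def B)
  have Lg2m: "Lg (2 * m) r = fact (2 * m - 1) / r ^ (2 * m)" for r
    using m(2) by (simp add: Lg_def)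
  have "norm x ^ 2 \<le> (norm (x - p) + norm p) ^ 2"
    using norm_triangle_ineq[of "x - p" p] by (intro power_mono) auto
  also have "\<dots> \<le> 2 * norm (x - p) ^ 2 + 2 * norm p ^ 2"
    using sum_squares_bound[of "norm (x - p)" "norm p"] by (simp add: power2_sum)
  finally have "t \<le> 2 * s + 2 * h"
    by (simp add: h_def s_def t_def)
  then have ts: "t + h \<le> 3 * (s + h)"
    using pos by (simp add: algebra_simps)
  \<comment> \<open>\<open>Q\<close> is the bubble at the origin and \<open>c k\<close> below is the
    k-th bubble of the difference, all without the common factor 4^m. The 3 just obtained enters a
    power 2m, which accounts for 9^m.\<close>
  define Q where "Q = h ^ m * Lg (2 * m) (t + h)"
  have Q: "Q \<ge> 0"
    using pos by (simp add: Q_def Lg2m)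
  have shift: "Lg (2 * m) (s + h) \<le> 9 ^ m * Lg (2 * m) (t + h)"
  proof -
    have "((t + h) / 3) ^ (2 * m) \<le> (s + h) ^ (2 * m)"
      using ts pos by (intro power_mono) auto
    then have "Lg (2 * m) (s + h) \<le> fact (2 * m - 1) / ((t + h) / 3) ^ (2 * m)"
      unfolding Lg2m using pos by (intro divide_left_mono) auto
    also have "\<dots> = 9 ^ m * Lg (2 * m) (t + h)"
      by (simp add: Lg2m power_divide power_mult)
    finally show ?thesis .
  qed
  define c where "c = (\<lambda>k. (b + real k * h) ^ m * Lg (2 * m) (s + (b + real k * h)))"
  have c_bounds: "0 \<le> c k" "c k \<le> (9 * (real m + 1)) ^ m * Q" if "k \<in> {1..m}" for k
  proof -
    have kh: "h \<le> b + real k * h"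
      using that pos b by (simp add: add_nonneg_pos less_imp_le mult_left_le_one_le add_increasing)
    then show "0 \<le> c k"
      unfolding c_def using pos by (simp add: Lg2m)
    have "b + real k * h \<le> h + real m * h"
      using that pos by (intro add_mono mult_right_mono) auto
    then have "(b + real k * h) ^ m \<le> ((real m + 1) * h) ^ m"
      using kh pos by (intro power_mono) (auto simp: algebra_simps)
    moreover have "Lg (2 * m) (s + (b + real k * h)) \<le> 9 ^ m * Lg (2 * m) (t + h)"
      by (rule order_trans[OF Lg_antimono shift]) (use kh pos in auto)
    ultimately have "c k \<le> ((real m + 1) * h) ^ m * (9 ^ m * Lg (2 * m) (t + h))"
      unfolding c_def using kh pos by (intro mult_mono) (auto simp: Lg2m)
    then show "c k \<le> (9 * (real m + 1)) ^ m * Q"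
      unfolding Q_def power_mult_distrib by (simp only: mult_ac)
  qed
  \<comment> \<open>The binomial coefficients sum to at most 2^m, and 2 times 9 (m + 1) is the base
    18 (m + 1) of \<open>B\<close>.\<close>
  have "\<bar>\<Sum>k\<in>{1..m}. (-1) ^ k * real (m choose k) * c k\<bar> \<le>
      (\<Sum>k\<in>{1..m}. real (m choose k) * ((9 * (real m + 1)) ^ m * Q))"
    by (rule order_trans[OF sum_abs sum_mono]) (use c_bounds in \<open>auto simp: abs_mult intro!: mult_left_mono\<close>)
  also have "\<dots> \<le> (\<Sum>k\<le>m. real (m choose k) * ((9 * (real m + 1)) ^ m * Q))"
    using Q by (intro sum_mono2) auto
  also have "\<dots> = 2 ^ m * ((9 * (real m + 1)) ^ m * Q)"
    by (simp add: choose_row_sum flip: sum_distrib_right of_nat_sum)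
  also have "\<dots> = B * Q"
    by (simp add: B flip: power_mult_distrib mult.assoc)
  finally have rest: "\<bar>\<Sum>k\<in>{1..m}. (-1) ^ k * real (m choose k) * c k\<bar> \<le> B * Q" .
  define E where "E = (\<Sum>k\<le>m. (-1) ^ k * real (m choose k) * c k) + B * Q"
  have "{..m} = insert 0 {1..m}" by auto
  then have "E = c 0 + (\<Sum>k\<in>{1..m}. (-1) ^ k * real (m choose k) * c k) + B * Q"
    by (simp add: E_def)
  then have E: "c 0 \<le> E" "E \<le> c 0 + 2 * B * Q"
    using rest by linarith+
  have lap: "- iter_laplacian m (profile m B K b p) x = 4 ^ m * (w * E)"
    unfolding iter_laplacian_profile[OF card m b(1) x] E_def c_def Q_def h_def w_def s_def t_def
    by (simp add: mult.assoc)
  have c0: "c 0 = b ^ m * Lg (2 * m) (s + b)" "c 0 \<ge> 0"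
    using pos b by (simp_all add: c_def Lg2m)
  show "0 \<le> - iter_laplacian m (profile m B K b p) x"
    unfolding lap using E(1) c0(2) pos by simp
  \<comment> \<open>The assumption 4 m - 2 \<le> \<kappa> is matched to this exponent: |x|^(-(4m-2))
    bounds, up to constants, both the weighted bubble at the origin and the weighted spike far from
    \<open>p\<close>.\<close>
  have tpow: "t ^ (2 * m - 1) = norm x ^ (4 * m - 2)"
    unfolding t_def power_mult[symmetric] by (simp add: diff_mult_distrib2)
  have far: "1 / t ^ (2 * m - 1) \<le> norm x powr - \<kappa> + 1"
    unfolding tpow using \<kappa> m pos by (intro inverse_power_le_powr) (auto simp: of_nat_diff)
  have wh: "w * h ^ m = h"
  proof -
    have "m = Suc (m - 1)" using m(2) by simp
    then have "h ^ m = h * h ^ (m - 1)" by (metis power_Suc)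
    moreover have "h ^ (m - 1) = norm p ^ (2 * m - 2)"
      by (simp add: h_def flip: power_mult) (simp add: right_diff_distrib')
    ultimately show ?thesis using pos by (simp add: w_def)
  qed
  have "t ^ (2 * m - 1) * h \<le> (t + h) ^ (2 * m - 1) * (t + h)"
    using pos by (intro mult_mono power_mono) auto
  also have "\<dots> = (t + h) ^ (2 * m)"
    using m(2) by (simp flip: power_Suc2)
  finally have "h / (t + h) ^ (2 * m) \<le> 1 / t ^ (2 * m - 1)"
    using pos by (simp add: field_simps)
  then have near: "h / (t + h) ^ (2 * m) \<le> norm x powr - \<kappa> + 1"
    using far by linarith
  have "w * Q = fact (2 * m - 1) * (h / (t + h) ^ (2 * m))"
    unfolding Q_def mult.assoc[symmetric] wh by (simp add: Lg2m)
  also have "\<dots> \<le> fact (2 * m - 1) * (norm x powr - \<kappa> + 1)"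
    by (rule mult_left_mono[OF near]) simp
  finally have wQ: "w * Q \<le> fact (2 * m - 1) * (norm x powr - \<kappa> + 1)" .
  \<comment> \<open>For |x| \<le> 2 |p| the peak value is used, and |p|^(-\<kappa>) is at most
    2^\<kappa> |x|^(-\<kappa>); farther out |x - p| \<ge> |x| / 2 and the decay of the bubble
    suffices.\<close>
  have wc: "w * c 0 \<le> fact (2 * m - 1) * ((2 powr \<kappa> + 16 ^ m) * (norm x powr - \<kappa> + 1))"
  proof (cases "norm x \<le> 2 * norm p")
    case True
    have "c 0 \<le> b ^ m * Lg (2 * m) b"
      unfolding c0 using b pos by (intro mult_left_mono Lg_antimono) auto
    also have "\<dots> = fact (2 * m - 1) * (1 / b ^ m)"
      using b(1) by (simp add: Lg2m power_mult power2_eq_square power_mult_distrib)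
    finally have "w * c 0 \<le> w * (fact (2 * m - 1) * (1 / b ^ m))"
      using pos by (intro mult_left_mono) auto
    also have "\<dots> = fact (2 * m - 1) * norm p powr - \<kappa>"
      unfolding b(3)[symmetric] by (simp add: w_def)
    also have "norm p powr - \<kappa> \<le> (norm x / 2) powr - \<kappa>"
      using True pos \<kappa> m by (intro powr_mono2') auto
    also have "(norm x / 2) powr - \<kappa> = 2 powr \<kappa> * norm x powr - \<kappa>"
      using pos by (simp add: powr_divide powr_minus field_simps)
    also have "2 powr \<kappa> * norm x powr - \<kappa> \<le> (2 powr \<kappa> + 16 ^ m) * (norm x powr - \<kappa> + 1)"
      by (intro mult_mono) auto
    finally show ?thesis by (simp add: mult_left_mono)
  next
    case False
    have "norm x / 2 \<le> norm (x - p)"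
      using False norm_triangle_ineq2[of x p] by simp
    then have "(norm x / 2) ^ 2 \<le> norm (x - p) ^ 2"
      by (intro power_mono) auto
    then have st: "t / 4 \<le> s" by (simp add: s_def t_def power_divide)
    have "norm p \<le> norm x"
      using False norm_ge_zero[of p] by linarith
    then have ht: "h \<le> t"
      unfolding h_def t_def by (intro power_mono) auto
    have "Lg (2 * m) (s + b) \<le> Lg (2 * m) (t / 4)"
      using st b pos by (intro Lg_antimono) auto
    moreover have "b ^ m \<le> h ^ m"
      using b pos by (intro power_mono) auto
    ultimately have "c 0 \<le> h ^ m * Lg (2 * m) (t / 4)"
      unfolding c0 using b pos by (intro mult_mono) (auto simp: Lg2m)
    then have "w * c 0 \<le> w * (h ^ m * Lg (2 * m) (t / 4))"
      using pos by (intro mult_left_mono) auto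
    also have "\<dots> = h * Lg (2 * m) (t / 4)"
      by (simp add: wh flip: mult.assoc)
    also have "\<dots> \<le> t * Lg (2 * m) (t / 4)"
      using ht pos by (intro mult_right_mono) (auto simp: Lg2m)
    also have "\<dots> = fact (2 * m - 1) * (16 ^ m * (1 / t ^ (2 * m - 1)))"
    proof -
      have "2 * m = Suc (2 * m - 1)" using m(2) by simp
      then have "t ^ (2 * m) = t * t ^ (2 * m - 1)" by (metis power_Suc)
      moreover have "(4::real) ^ (2 * m) = 16 ^ m" by (simp add: power_mult)
      ultimately show ?thesis using pos by (simp add: Lg2m power_divide)
    qed
    also have "16 ^ m * (1 / t ^ (2 * m - 1)) \<le> (2 powr \<kappa> + 16 ^ m) * (norm x powr - \<kappa> + 1)"
      using far pos by (intro mult_mono) auto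
    finally show ?thesis by (simp add: mult_left_mono)
  qed
  have "w * E \<le> w * c 0 + 2 * B * (w * Q)"
    using mult_left_mono[OF E(2), of w] pos by (simp add: algebra_simps)
  also have "\<dots> \<le> fact (2 * m - 1) * ((2 powr \<kappa> + 16 ^ m) * (norm x powr - \<kappa> + 1)) +
      2 * B * (fact (2 * m - 1) * (norm x powr - \<kappa> + 1))"
    using wQ wc pos by (intro add_mono mult_left_mono) auto
  also have "\<dots> = fact (2 * m - 1) * (2 powr \<kappa> + 16 ^ m + 2 * B) * (norm x powr - \<kappa> + 1)"
    by (simp add: algebra_simps)
  finally have "4 ^ m * (w * E) \<le> 4 ^ m * (fact (2 * m - 1) * (2 powr \<kappa> + 16 ^ m + 2 * B) * (norm x powr - \<kappa> + 1))"
    by (intro mult_left_mono) auto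
  then show "- iter_laplacian m (profile m B K b p) x \<le>
      4 ^ m * fact (2 * m - 1) * (2 powr \<kappa> + 16 ^ m + 2 * B) * (norm x powr - \<kappa> + 1)"
    unfolding lap by (simp add: mult.assoc)
qed

text \<open>The part 2 B of \<open>K\<close> pays for the remainder, whose weight |p|^(-(2m-2))
  cancels the factor h^(m-1) exactly. \<open>K0\<close> is what is left over.\<close>

lemma profile_lower_bound:
  fixes p x :: "real^'n::finite"
  assumes m: "m \<ge> 2" and p: "p \<noteq> 0" and x: "x \<noteq> 0" and B: "B \<ge> 0" and K: "K = 2 * B + K0" "K0 \<ge> 0"
  shows "profile m B K b p x \<ge> (1 / norm p ^ (2 * m - 2)) *
      step_diff m (norm p ^ 2) (Lg 0) (norm (x - p) ^ 2 + b) + K0 * (1 / norm x ^ (2 * m - 2) + 1)"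
proof -
  define h w t where "h = norm p ^ 2" and "w = 1 / norm p ^ (2 * m - 2)" and "t = norm x ^ 2"
  have pos: "h > 0" "t > 0" "w > 0"
    using p x by (auto simp: h_def t_def w_def)
  have wh: "w * h ^ (m - 1) = 1"
  proof -
    have "h ^ (m - 1) = norm p ^ (2 * m - 2)"
      by (simp add: h_def flip: power_mult) (simp add: right_diff_distrib')
    then show ?thesis using p by (simp add: w_def)
  qed
  have Lg: "Lg (m - 1) t \<ge> 1 / norm x ^ (2 * m - 2)"
  proof -
    have "t ^ (m - 1) = norm x ^ (2 * m - 2)"
      by (simp add: t_def flip: power_mult) (simp add: right_diff_distrib')
    then show ?thesis
      using m by (simp add: Lg_def divide_right_mono)
  qed
  \<comment> \<open>Estimated through order m - 1 and one further Taylor term: the direct bound of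
    order m carries t^(-m), too singular at the origin to be absorbed by |x|^(-(2m-2)).\<close>
  have "\<bar>Lg_remainder m h 0 t\<bar> \<le> 2 * (h ^ (m - 1) * Lg (m - 1) t)"
  proof -
    define c where "c = (- h) ^ (m - 1) / fact (m - 1) * Lg (m - 1) t"
    have "Lg_remainder m h 0 t = Lg_remainder (m - 1) h 0 t - c"
      using m by (cases m) (simp_all add: Lg_remainder_def c_def)
    moreover have "\<bar>Lg_remainder (m - 1) h 0 t\<bar> \<le> h ^ (m - 1) * Lg (m - 1) t"
      using abs_Lg_remainder_le[of t h "m - 1" 0] pos m by simp
    moreover have "\<bar>c\<bar> = (h ^ (m - 1) * Lg (m - 1) t) / fact (m - 1)"
      using pos Lg_pos[of "m - 1" t] m by (simp add: c_def abs_mult power_abs)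
    moreover have "(h ^ (m - 1) * Lg (m - 1) t) / fact (m - 1) \<le> h ^ (m - 1) * Lg (m - 1) t"
      using divide_left_mono[of 1 "fact (m - 1)" "h ^ (m - 1) * Lg (m - 1) t"] pos Lg_pos[of "m - 1" t] m
      by (simp add: fact_ge_1)
    ultimately show ?thesis by linarith
  qed
  then have "w * (B * \<bar>Lg_remainder m h 0 t\<bar>) \<le> w * (B * (2 * (h ^ (m - 1) * Lg (m - 1) t)))"
    using pos B by (intro mult_left_mono) auto
  also have "\<dots> = 2 * B * (w * h ^ (m - 1)) * Lg (m - 1) t"
    by (simp add: mult_ac)
  finally have "w * (B * \<bar>Lg_remainder m h 0 t\<bar>) \<le> 2 * B * Lg (m - 1) t"
    by (simp only: wh mult_1_right)
  moreover have "w * (B * - \<bar>Lg_remainder m h 0 t\<bar>) \<le> w * (B * Lg_remainder m h 0 t)"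
    using pos B by (intro mult_left_mono) auto
  ultimately have "w * (B * Lg_remainder m h 0 t) \<ge> - (2 * B * Lg (m - 1) t)"
    by simp
  moreover have "K0 * Lg (m - 1) t \<ge> K0 * (1 / norm x ^ (2 * m - 2))"
    using Lg K by (intro mult_left_mono) auto
  ultimately show ?thesis
    unfolding profile_def h_def[symmetric] w_def[symmetric] t_def[symmetric]
    using B K by (simp add: algebra_simps)
qed

text \<open>With h factored out of b + k h, the terms ln h cancel because the alternating binomial
  sum is zero. The term k = 0 gives ln (h / b), and each other logarithm lies between 0 and ln (m +
  1).\<close>

lemma step_diff_ln_lower_bound:
  assumes "0 < b" "b \<le> h" "m > 0"
  shows "step_diff m h (Lg 0) b \<ge> ln (h / b) - 2 ^ m * ln (real m + 1)"
proof -
  have h: "h > 0" using assms by linarith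
  have "ln (b + real k * h) = ln h + ln (b / h + real k)" for k
    using assms h by (subst ln_mult_pos[symmetric]) (auto simp: field_simps add_pos_nonneg)
  then have "step_diff m h (Lg 0) b =
    (\<Sum>k\<le>m. - ((-1) ^ k * real (m choose k)) * ln h + - ((-1) ^ k * real (m choose k)) * ln (b / h + real k))"
    unfolding step_diff_eq_sum Lg_0 by (simp add: algebra_simps)
  also have "\<dots> = - (\<Sum>k\<le>m. (-1) ^ k * real (m choose k)) * ln h +
      (\<Sum>k\<le>m. - ((-1) ^ k * real (m choose k)) * ln (b / h + real k))"
    by (simp add: sum_subtractf sum_distrib_right sum_negf)
  also have "(\<Sum>k\<le>m. (-1) ^ k * real (m choose k)) = 0"
    using choose_alternating_sum[OF assms(3), where 'a = real] by simp
  also have "{..m} = insert 0 {1..m}" by auto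
  also have "(\<Sum>k\<in>insert 0 {1..m}. - ((-1) ^ k * real (m choose k)) * ln (b / h + real k)) =
      ln (h / b) + (\<Sum>k\<in>{1..m}. - ((-1) ^ k * real (m choose k)) * ln (b / h + real k))"
    using assms h by (simp add: ln_div)
  finally have eq: "step_diff m h (Lg 0) b =
      ln (h / b) + (\<Sum>k\<in>{1..m}. - ((-1) ^ k * real (m choose k)) * ln (b / h + real k))"
    by simp
  have "\<bar>\<Sum>k\<in>{1..m}. - ((-1) ^ k * real (m choose k)) * ln (b / h + real k)\<bar> \<le>
      (\<Sum>k\<in>{1..m}. real (m choose k) * ln (real m + 1))"
  proof (rule order_trans[OF sum_abs sum_mono])
    fix k assume k: "k \<in> {1..m}"
    have "b / h \<le> 1" "b / h > 0" using assms h by auto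
    then have "b / h + real k \<le> real m + 1" "b / h + real k \<ge> 1"
      using k by (simp_all add: add.commute add_mono)
    then have "0 \<le> ln (b / h + real k)" "ln (b / h + real k) \<le> ln (real m + 1)"
      by auto
    then show "\<bar>- ((-1) ^ k * real (m choose k)) * ln (b / h + real k)\<bar> \<le> real (m choose k) * ln (real m + 1)"
      by (simp add: abs_mult mult_left_mono)
  qed
  also have "\<dots> \<le> (\<Sum>k\<le>m. real (m choose k) * ln (real m + 1))"
    by (intro sum_mono2) auto
  also have "\<dots> = 2 ^ m * ln (real m + 1)"
    by (simp add: choose_row_sum flip: sum_distrib_right of_nat_sum)
  finally show ?thesis
    unfolding eq by linarith
qed

text \<open>The spike and the centred part are separate chains, around \<open>p j\<close> and around
  0. Uniformity in \<open>j\<close> rests on \<open>w j * h j ^ m = h j\<close> and h \<le> 1: the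
  difference and the remainder each gain h^m, which absorbs the weight.\<close>

lemma equismooth_profile:
  fixes p :: "nat \<Rightarrow> real^'n::finite"
  assumes m: "m \<ge> 2" and p: "\<And>j. p j \<noteq> 0" "\<And>j. norm (p j) \<le> 1"
    and b: "\<And>j. b j = norm (p j) powr \<gamma>" and \<gamma>: "\<gamma> \<ge> 0"
  shows "equismooth (- {0}) (\<lambda>j. profile m B K (b j) (p j))"
proof -
  let ?S = "- {0 :: real^'n}"
  define h w where "h = (\<lambda>j. norm (p j) ^ 2)" and "w = (\<lambda>j. 1 / norm (p j) ^ (2 * m - 2))"
  have pos: "h j > 0" "w j > 0" "b j > 0" "h j \<le> 1" "norm (p j) > 0" for j
    using p by (auto simp: h_def w_def b power_le_one)
  have wh: "w j * h j ^ m = h j" for j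
  proof -
    have "m = Suc (m - 1)" using m by simp
    then have "h j ^ m = h j * h j ^ (m - 1)" by (metis power_Suc)
    moreover have "h j ^ (m - 1) = norm (p j) ^ (2 * m - 2)"
      by (simp add: h_def flip: power_mult) (simp add: right_diff_distrib')
    ultimately show ?thesis using pos[of j] by (simp add: w_def)
  qed
  have openS: "open ?S" by (simp add: open_Compl)
  have halfball: "ball x (norm x / 2) \<subseteq> ?S" "y \<in> ball x (norm x / 2) \<Longrightarrow> norm x / 2 \<le> norm y"
    if "x \<in> ?S" for x y :: "real^'n"
  proof -
    have "norm x / 2 \<le> norm y" if "y \<in> ball x (norm x / 2)" for y
      using that norm_triangle_ineq2[of x y] by (simp add: dist_norm)
    with that show "ball x (norm x / 2) \<subseteq> ?S" "y \<in> ball x (norm x / 2) \<Longrightarrow> norm x / 2 \<le> norm y"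
      by fastforce+
  qed
  define \<Phi> where "\<Phi> = (\<lambda>q j x. w j * step_diff m (h j) (Lg q) (norm (x - p j) ^ 2 + b j))"
  have \<Phi>: "equismooth ?S (\<Phi> 0)"
  proof (rule equismooth_chain)
    fix q j
    have "((\<lambda>s. w j * step_diff m (h j) (Lg q) s) has_real_derivative
        w j * - step_diff m (h j) (Lg (Suc q)) (norm (x - p j) ^ 2 + b j)) (at (norm (x - p j) ^ 2 + b j))"
      for x :: "real^'n"
      using pos[of j] by (intro DERIV_cmult has_real_derivative_step_diff_Lg add_nonneg_pos) auto
    from has_partials_radial[of ?S _ _ "p j" "b j", OF this]
    show "has_partials (\<Phi> q j) (\<lambda>i x. - 2 * ((x $ i - p j $ i) * \<Phi> (Suc q) j x)) ?S"
      by (simp add: \<Phi>_def algebra_simps)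
  next
    show "bounded (range p)"
      using p(2) by (auto simp: bounded_iff)
  next
    fix q
    show "locally_equibounded ?S (\<Phi> q)"
      unfolding locally_equibounded_def
    proof
      fix x assume x: "x \<in> ?S"
      \<comment> \<open>A lower bound for |y - p j|^2 + b j uniform in \<open>j\<close>: either |p
        j| \<le> |x| / 4, so that \<open>p j\<close> is far from y, or \<open>b j\<close> itself is
        at least (|x| / 4)^\<gamma>.\<close>
      define \<sigma> where "\<sigma> = min ((norm x / 4) ^ 2) ((norm x / 4) powr \<gamma>)"
      have \<sigma>: "\<sigma> > 0" using x by (simp add: \<sigma>_def)
      have "\<bar>\<Phi> q j y\<bar> \<le> Lg (q + m) \<sigma>" if y: "y \<in> ball x (norm x / 2)" for j y
      proof -
        have ge: "norm (y - p j) ^ 2 + b j \<ge> \<sigma>"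
        proof (cases "norm (p j) \<le> norm x / 4")
          case True
          then have "norm x / 4 \<le> norm (y - p j)"
            using halfball(2)[OF x y] norm_triangle_ineq2[of y "p j"] by linarith
          then have "(norm x / 4) ^ 2 \<le> norm (y - p j) ^ 2"
            by (intro power_mono) auto
          then show ?thesis
            unfolding \<sigma>_def using pos(3)[of j] by linarith
        next
          case False
          then have "(norm x / 4) powr \<gamma> \<le> b j"
            unfolding b using \<gamma> by (intro powr_mono2) auto
          moreover have "norm (y - p j) ^ 2 \<ge> 0" by simp
          ultimately show ?thesis
            unfolding \<sigma>_def by linarith
        qed
        then have s: "norm (y - p j) ^ 2 + b j > 0" using \<sigma> by linarith
        have bounds: "0 \<le> step_diff m (h j) (Lg q) (norm (y - p j) ^ 2 + b j)"
          "step_diff m (h j) (Lg q) (norm (y - p j) ^ 2 + b j) \<le> h j ^ m * Lg (q + m) (norm (y - p j) ^ 2 + b j)"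
          using step_diff_Lg_bounds[OF s pos(1)[of j], of m q] m by auto
        then have "\<bar>\<Phi> q j y\<bar> = \<Phi> q j y"
          using pos[of j] by (simp add: \<Phi>_def)
        also have "\<dots> \<le> w j * (h j ^ m * Lg (q + m) (norm (y - p j) ^ 2 + b j))"
          unfolding \<Phi>_def using bounds(2) pos[of j] by (intro mult_left_mono) auto
        also have "\<dots> = h j * Lg (q + m) (norm (y - p j) ^ 2 + b j)"
          by (simp add: wh flip: mult.assoc)
        also have "\<dots> \<le> 1 * Lg (q + m) \<sigma>"
          using pos[of j] \<sigma> ge s m Lg_pos[of "q + m"] by (intro mult_mono Lg_antimono) (auto simp: less_imp_le)
        finally show ?thesis by simp
      qed
      then show "\<exists>r>0. \<exists>C. ball x r \<subseteq> ?S \<and> (\<forall>j. \<forall>y\<in>ball x r. \<bar>\<Phi> q j y\<bar> \<le> C)"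
        using x halfball(1)[OF x] by (intro exI[of _ "norm x / 2"] conjI exI[of _ "Lg (q + m) \<sigma>"]) auto
    qed
  qed (rule openS)
  \<comment> \<open>\<open>Lg_remainder\<close> and \<open>Lg\<close> obey the same derivative rule,
    so both fit into one chain; the constant \<open>K\<close> is added separately.\<close>
  define \<Psi> where "\<Psi> = (\<lambda>q j (x::real^'n). B * w j * Lg_remainder m (h j) q (norm x ^ 2) + K * Lg (m - 1 + q) (norm x ^ 2))"
  have \<Psi>: "equismooth ?S (\<Psi> 0)"
  proof (rule equismooth_chain)
    fix q j
    have "((\<lambda>s. B * w j * Lg_remainder m (h j) q s + K * Lg (m - 1 + q) s) has_real_derivative
        B * w j * - Lg_remainder m (h j) (Suc q) (norm (x - 0) ^ 2 + 0) +
        K * - Lg (Suc (m - 1 + q)) (norm (x - 0) ^ 2 + 0)) (at (norm (x - 0) ^ 2 + 0))"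
      if "x \<in> ?S" for x :: "real^'n"
      using pos[of j] that by (intro DERIV_add DERIV_cmult has_real_derivative_Lg_remainder has_real_derivative_Lg) auto
    from has_partials_radial[of ?S _ _ 0 0, OF this]
    show "has_partials (\<Psi> q j) (\<lambda>i x. - 2 * ((x $ i - 0 $ i) * \<Psi> (Suc q) j x)) ?S"
      by (simp add: \<Psi>_def algebra_simps)
  next
    show "bounded (range (\<lambda>j. 0 :: real^'n))" by simp
  next
    fix q
    show "locally_equibounded ?S (\<Psi> q)"
      unfolding locally_equibounded_def
    proof
      fix x assume x: "x \<in> ?S"
      define \<sigma> where "\<sigma> = (norm x / 2) ^ 2"
      have \<sigma>: "\<sigma> > 0" using x by (simp add: \<sigma>_def)
      have "\<bar>\<Psi> q j y\<bar> \<le> \<bar>B\<bar> * Lg (q + m) \<sigma> + \<bar>K\<bar> * Lg (m - 1 + q) \<sigma>"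
        if y: "y \<in> ball x (norm x / 2)" for j y
      proof -
        have ge: "norm y ^ 2 \<ge> \<sigma>"
          unfolding \<sigma>_def using halfball(2)[OF x y] by (intro power_mono) auto
        then have s: "norm y ^ 2 > 0" using \<sigma> by linarith
        have "w j * \<bar>Lg_remainder m (h j) q (norm y ^ 2)\<bar> \<le> w j * (h j ^ m * Lg (q + m) (norm y ^ 2))"
          using abs_Lg_remainder_le[OF s, of "h j" m q] pos[of j] m by (intro mult_left_mono) auto
        also have "\<dots> = h j * Lg (q + m) (norm y ^ 2)"
          by (simp add: wh flip: mult.assoc)
        also have "\<dots> \<le> 1 * Lg (q + m) \<sigma>"
          using pos[of j] \<sigma> ge s m Lg_pos[of "q + m"] by (intro mult_mono Lg_antimono) (auto simp: less_imp_le)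
        finally have "\<bar>B * w j * Lg_remainder m (h j) q (norm y ^ 2)\<bar> \<le> \<bar>B\<bar> * Lg (q + m) \<sigma>"
          using pos[of j] by (simp add: abs_mult mult.assoc mult_left_mono)
        moreover have "\<bar>K * Lg (m - 1 + q) (norm y ^ 2)\<bar> \<le> \<bar>K\<bar> * Lg (m - 1 + q) \<sigma>"
          using Lg_antimono[OF \<sigma> ge, of "m - 1 + q"] Lg_pos[of "m - 1 + q", OF _ s] m
          by (simp add: abs_mult mult_left_mono)
        ultimately show ?thesis
          unfolding \<Psi>_def by linarith
      qed
      then show "\<exists>r>0. \<exists>C. ball x r \<subseteq> ?S \<and> (\<forall>j. \<forall>y\<in>ball x r. \<bar>\<Psi> q j y\<bar> \<le> C)"
        using x halfball(1)[OF x]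
        by (intro exI[of _ "norm x / 2"] conjI exI[of _ "\<bar>B\<bar> * Lg (q + m) \<sigma> + \<bar>K\<bar> * Lg (m - 1 + q) \<sigma>"]) auto
    qed
  qed (rule openS)
  have "equismooth ?S (\<lambda>j x. \<Phi> 0 j x + (\<Psi> 0 j x + K))"
    by (rule equismooth_add[OF \<Phi> equismooth_add[OF \<Psi> equismooth_const[OF openS]]])
  also have "(\<lambda>j x. \<Phi> 0 j x + (\<Psi> 0 j x + K)) = (\<lambda>j. profile m B K (b j) (p j))"
    unfolding \<Phi>_def \<Psi>_def profile_def h_def w_def by (intro ext) (simp add: algebra_simps)
  finally show ?thesis .
qed

section \<open>Blow-up along a sequence and the choice of scales\<close>

lemma Limsup_at_eq_PInfty:
  fixes f :: "'a::topological_space \<Rightarrow> real"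
  assumes p: "filterlim p (at a) sequentially" and f: "filterlim (\<lambda>j. f (p j)) at_top sequentially"
  shows "Limsup (at a) (\<lambda>x. ereal (f x)) = \<infinity>"
proof -
  have "((\<lambda>j. ereal (f (p j))) \<longlongrightarrow> \<infinity>) sequentially"
    using f by (simp add: tendsto_PInfty_eq_at_top)
  then have "\<infinity> = Limsup sequentially (\<lambda>j. ereal (f (p j)))"
    by (intro lim_imp_Limsup[symmetric]) auto
  also have "\<dots> \<le> Limsup (filtermap p sequentially) (\<lambda>x. ereal (f x))"
    by (rule Limsup_filtermap_ge)
  also have "\<dots> \<le> Limsup (at a) (\<lambda>x. ereal (f x))"
    using p unfolding filterlim_def Limsup_def le_filter_def
    by (intro INF_superset_mono) auto
  finally show ?thesis by simp
qed

text \<open>Each requirement holds for all small a, so a scale can be picked for every j. The bound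
  4^(-j) on \<phi> leaves a factor 2^j against the weight 2^(-j) of the series.\<close>

lemma exists_small_scales:
  fixes \<phi> :: "real \<Rightarrow> real"
  assumes "(\<phi> \<longlongrightarrow> 0) (at_right 0)" and D: "D > 0"
  shows "\<exists>a. \<forall>j. 0 < a j \<and> a j < 1 \<and> a j < 1 / real (Suc j) \<and> \<phi> (a j) \<le> (1/4) ^ j \<and>
    D * ln (1 / a j) - M \<ge> D / 4 * ln (5 / a j)"
proof -
  \<comment> \<open>For L = ln (1 / a) \<ge> X, half of D L absorbs \<open>M\<close>, and ln 5 \<le>
    L turns the other half into D / 4 times ln 5 + L.\<close>
  define X where "X = max (2 * M / D) (ln 5)"
  have "\<exists>a. 0 < a \<and> a < 1 \<and> a < 1 / real (Suc j) \<and> \<phi> a \<le> (1/4) ^ j \<and>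
      D * ln (1 / a) - M \<ge> D / 4 * ln (5 / a)" for j
  proof -
    have "\<forall>\<^sub>F a in at_right 0. \<phi> a < (1/4) ^ j"
      using assms(1) by (rule order_tendstoD) simp
    moreover have "\<forall>\<^sub>F a in at_right 0. a < min 1 (1 / real (Suc j))"
      by (rule order_tendstoD[OF tendsto_ident_at]) simp
    moreover have "\<forall>\<^sub>F a in at_right (0::real). a > 0"
      by (simp add: eventually_at_right_less)
    moreover have "\<forall>\<^sub>F a in at_right 0. ln a \<le> - X"
      using ln_at_0 unfolding filterlim_at_bot by blast
    ultimately have "\<forall>\<^sub>F a in at_right 0. 0 < a \<and> a < 1 \<and> a < 1 / real (Suc j) \<and> \<phi> a \<le> (1/4) ^ j \<and>
      D * ln (1 / a) - M \<ge> D / 4 * ln (5 / a)"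
    proof eventually_elim
      case (elim a)
      define L where "L = ln (1 / a)"
      have L: "L = - ln a" "ln (5 / a) = ln 5 + L"
        using elim by (simp_all add: L_def ln_div)
      have "2 * M / D \<le> L" "ln 5 \<le> L"
        using elim by (auto simp: L X_def)
      then have "2 * M \<le> D * L" "D * ln 5 \<le> D * L"
        using D by (simp_all add: field_simps)
      then have "D * L - M \<ge> D / 4 * (ln 5 + L)"
        by (simp add: field_simps)
      moreover have "a < 1"
        by (rule less_le_trans[OF elim(2) min.cobounded1])
      moreover have "a < 1 / real (Suc j)"
        by (rule less_le_trans[OF elim(2) min.cobounded2])
      ultimately show ?case
        using elim(1,3) by (simp add: L(2) flip: L_def)
    qed
    then show ?thesis
      by (rule eventually_happens'[OF trivial_limit_at_right_real])
  qed
  then show ?thesis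
    by (intro choice allI)
qed

section \<open>The solution\<close>

theorem theorem1p8:
  fixes m :: nat and lam :: real and \<phi> :: "real \<Rightarrow> real"
  assumes "odd m" and "m \<ge> 3"
    and "CARD('n::finite) = 2 * m"
    and "lam > (2 * real CARD('n) - 2) / (real CARD('n) - 2)"
    and "continuous_on {0<..<1} \<phi>"
    and "\<phi> ` {0<..<1} \<subseteq> {0<..<1}"
    and "(\<phi> \<longlongrightarrow> 0) (at_right 0)"
  shows "\<exists>u :: real^'n \<Rightarrow> real.
           smooth_on u (- {0}) \<and>
           (\<forall>x. x \<noteq> 0 \<longrightarrow> u x > 0) \<and>
           (\<forall>x. x \<noteq> 0 \<longrightarrow> 0 \<le> - iter_laplacian m u x \<and> - iter_laplacian m u x \<le> u x powr lam) \<and>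
           Limsup (at 0) (\<lambda>x. ereal (u x / (\<phi> (norm x) * norm x powr (- (real CARD('n) - 2))
                                                * ln (5 / norm x)))) = \<infinity>"
proof -

  \<comment> \<open>Choice of parameters and scales\<close>
  note m = assms(1,2) and card = assms(3)
  define d where "d = 2 * real m - 2"
  have d: "d > 0" "real CARD('n) - 2 = d" "real (2 * m - 2) = d"
    using m card by (auto simp: d_def of_nat_diff)
  \<comment> \<open>|x|^(-\<kappa>) is the base |x|^(-d) raised to the power \<open>lam\<close>. The
    exponent \<gamma> solves a^d (a^\<gamma>)^m = a^\<kappa>, and D is the exponent in a^2 / b =
    a^(-D).\<close>
  define \<kappa> \<gamma> D where "\<kappa> = d * lam" and "\<gamma> = (\<kappa> - d) / real m" and "D = \<gamma> - 2"
  have lam_gt: "(4 * real m - 2) / d < lam"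
    using assms(4) card by (simp add: d_def)
  \<comment> \<open>The hypothesis on \<open>lam\<close> in terms of \<kappa>; as 2 m + d = 4 m - 2,
    it is equivalent to \<gamma> > 2.\<close>
  then have \<kappa>: "4 * real m - 2 < \<kappa>"
    using d by (simp add: \<kappa>_def field_simps)
  have "1 < (4 * real m - 2) / d"
    using d m by (simp add: d_def field_simps)
  then have lam: "lam > 1" using lam_gt by linarith
  have D: "D > 0"
    using \<kappa> m by (simp add: D_def \<gamma>_def d_def field_simps)
  then have \<gamma>: "\<gamma> > 2" by (simp add: D_def)
  define B where "B = (18 * (real m + 1)) ^ m"
  define C where "C = 4 ^ m * fact (2 * m - 1) * (2 powr \<kappa> + 16 ^ m + 2 * B)"
  \<comment> \<open>The factor 2 is the sum of the weights (1/2)^j; K0 \<ge> 1 later permits moving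
    2 K0 inside the power \<open>lam\<close>.\<close>
  define K0 where "K0 = max 1 (2 * C)"
  define K where "K = 2 * B + K0"
  have K0: "K0 \<ge> 1" "2 * C \<le> K0" and B: "B \<ge> 0"
    by (auto simp: K0_def B_def)
  obtain a where a: "\<And>j. 0 < a j" "\<And>j. a j < 1" "\<And>j. a j < 1 / real (Suc j)"
    "\<And>j. \<phi> (a j) \<le> (1/4) ^ j" "\<And>j. D * ln (1 / a j) - 2 ^ m * ln (real m + 1) \<ge> D / 4 * ln (5 / a j)"
    using exists_small_scales[OF assms(7) D, of "2 ^ m * ln (real m + 1)"] by blast
  define e where "e = (axis undefined 1 :: real^'n)"
  have e: "norm e = 1" by (simp add: e_def)
  define p b where "p = (\<lambda>j. a j *\<^sub>R e)" and "b = (\<lambda>j. a j powr \<gamma>)"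
  have p: "norm (p j) = a j" "p j \<noteq> 0" for j
    using a(1)[of j] e by (auto simp: p_def)
  have b: "0 < b j" "b j \<le> norm (p j) ^ 2" "1 / (norm (p j) ^ (2 * m - 2) * b j ^ m) = norm (p j) powr - \<kappa>" for j
  proof -
    show "0 < b j" using a(1)[of j] by (simp add: b_def)
    have "b j \<le> a j powr 2"
      unfolding b_def using a(1,2)[of j] \<gamma> by (intro powr_mono') auto
    then show "b j \<le> norm (p j) ^ 2"
      using a(1)[of j] by (simp add: p powr_realpow flip: powr_numeral)
    have "b j ^ m = a j powr (\<kappa> - d)"
      using a(1)[of j] m by (simp add: b_def powr_power \<gamma>_def)
    moreover have "a j ^ (2 * m - 2) = a j powr d"
      unfolding d(3)[symmetric] using a(1)[of j] by (simp add: powr_realpow)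
    ultimately show "1 / (norm (p j) ^ (2 * m - 2) * b j ^ m) = norm (p j) powr - \<kappa>"
      using a(1)[of j] by (simp add: p powr_minus inverse_eq_divide flip: powr_add)
  qed

  \<comment> \<open>The series and its bounds\<close>
  define T where "T = (\<lambda>j. profile m B K (b j) (p j))"
  define u where "u = (\<lambda>x. \<Sum>j. (1/2) ^ j * T j x)"
  have smooth: "equismooth (- {0}) T"
    unfolding T_def using m p a \<gamma> by (intro equismooth_profile[of m p b \<gamma>]) (auto simp: b_def less_imp_le)
  have S: "open (- {0 :: real^'n})" by (simp add: open_Compl)
  have sums: "(\<lambda>j. (1/2) ^ j * T j x) sums u x" if "x \<noteq> 0" for x
    unfolding u_def
    by (intro summable_sums locally_equibounded_summable[OF equismooth_locally_equibounded[OF smooth]]) (use that in auto)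
  have geometric: "(\<lambda>j. (1/2) ^ j * c) sums (2 * c)" for c :: real
    using sums_mult2[OF geometric_sums[of "1/2 :: real"], of c] by simp
  have "norm x powr - d = 1 / norm x ^ (2 * m - 2)" if "x \<noteq> 0" for x :: "real^'n"
    unfolding d(3)[symmetric] using that by (simp add: powr_minus powr_realpow inverse_eq_divide)
  then have lower: "T j x \<ge> (1 / norm (p j) ^ (2 * m - 2)) *
      step_diff m (norm (p j) ^ 2) (Lg 0) (norm (x - p j) ^ 2 + b j) + K0 * (norm x powr - d + 1)"
    if "x \<noteq> 0" for j x
    unfolding T_def using profile_lower_bound[OF _ p(2) that B K_def, of m j "b j"] K0 m that by auto
  have spike_nonneg: "(1 / norm (p j) ^ (2 * m - 2)) *
      step_diff m (norm (p j) ^ 2) (Lg 0) (norm (x - p j) ^ 2 + b j) \<ge> 0" for j x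
  proof -
    have "norm (x - p j) ^ 2 + b j > 0"
      using b(1)[of j] by (intro add_nonneg_pos) auto
    then show ?thesis
      using step_diff_Lg_bounds[of "norm (x - p j) ^ 2 + b j" "norm (p j) ^ 2" m 0] p m a(1)[of j] by auto
  qed
  have T_ge: "T j x \<ge> K0 * (norm x powr - d + 1)" if "x \<noteq> 0" for j x
    using lower[OF that, of j] spike_nonneg[of j x] by linarith
  have u_ge: "u x \<ge> 2 * K0 * (norm x powr - d + 1)" if "x \<noteq> 0" for x
    using sums_le[OF _ geometric sums[OF that], of "K0 * (norm x powr - d + 1)"] T_ge[OF that]
    by (simp add: mult.assoc mult_left_mono)
  have base_pos: "2 * K0 * (norm x powr - d + 1) > 0" for x :: "real^'n"
    using K0 by (intro mult_pos_pos add_nonneg_pos) auto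
  have lap_sums: "(\<lambda>j. (1/2) ^ j * - iter_laplacian m (T j) x) sums - iter_laplacian m u x" if "x \<noteq> 0" for x
    using sums_minus[OF equismooth_series_iter_laplacian[OF smooth S, of x m]] that by (simp add: u_def)
  have lap_bounds: "0 \<le> - iter_laplacian m (T j) x"
    "- iter_laplacian m (T j) x \<le> C * (norm x powr - \<kappa> + 1)" if "x \<noteq> 0" for j x
    using profile_laplacian_bounds[OF card m(1) _ p(2) that b _ B_def] m \<kappa> unfolding T_def C_def by auto

  \<comment> \<open>Verification of the required properties\<close>
  have "smooth_on u (- {0})"
    unfolding u_def by (rule equismooth_series_smooth_on[OF smooth S])
  moreover have "u x > 0" if "x \<noteq> 0" for x
    using u_ge[OF that] base_pos[of x] by linarith
  moreover have "0 \<le> - iter_laplacian m u x" if "x \<noteq> 0" for x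
    by (rule sums_le[OF mult_nonneg_nonneg[OF _ lap_bounds(1)[OF that]] sums_zero lap_sums[OF that]]) simp
  moreover have "- iter_laplacian m u x \<le> u x powr lam" if x: "x \<noteq> 0" for x
  proof -
    define A where "A = norm x powr - d"
    have A: "A \<ge> 0" by (simp add: A_def)
    have "- iter_laplacian m u x \<le> 2 * (C * (norm x powr - \<kappa> + 1))"
      by (rule sums_le[OF mult_left_mono[OF lap_bounds(2)[OF x]] lap_sums[OF x] geometric]) simp
    also have "norm x powr - \<kappa> = A powr lam"
      by (simp add: A_def \<kappa>_def powr_powr)
    also have "2 * (C * (A powr lam + 1)) \<le> K0 * (A powr lam + 1)"
      using mult_right_mono[OF K0(2), of "A powr lam + 1"] by (simp add: mult.assoc)
    \<comment> \<open>Both A^lam and 1 are at most (A + 1)^lam; then lam > 1 and 2 K0 \<ge> 1 bring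
      the constant under the power.\<close>
    also have "\<dots> \<le> K0 * ((A + 1) powr lam + (A + 1) powr lam)"
      using A lam K0 by (intro mult_left_mono add_mono powr_mono2 ge_one_powr_ge_zero) auto
    also have "\<dots> = (2 * K0) powr 1 * (A + 1) powr lam"
      using K0 by simp
    also have "\<dots> \<le> (2 * K0) powr lam * (A + 1) powr lam"
      using K0 lam by (intro mult_right_mono powr_mono) auto
    also have "\<dots> = (2 * K0 * (A + 1)) powr lam"
      using K0 A by (simp add: powr_mult)
    also have "\<dots> \<le> u x powr lam"
      using u_ge[OF x] K0 A lam by (intro powr_mono2) (auto simp: A_def)
    finally show ?thesis .
  qed
  moreover have "Limsup (at 0) (\<lambda>x. ereal (u x / (\<phi> (norm x) * norm x powr (- (real CARD('n) - 2))
      * ln (5 / norm x)))) = \<infinity>"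
    unfolding d(2)
  proof (rule Limsup_at_eq_PInfty)
    have "(\<lambda>j. norm (p j)) \<longlonglongrightarrow> 0"
    proof (rule tendsto_sandwich[OF _ _ tendsto_const LIMSEQ_Suc[OF lim_1_over_n]])
      show "\<forall>\<^sub>F j in sequentially. norm (p j) \<le> 1 / of_nat (Suc j)"
        using a(3) by (auto simp: p less_imp_le)
    qed simp
    then have "p \<longlonglongrightarrow> 0"
      by (rule tendsto_norm_zero_cancel)
    then show "filterlim p (at 0) sequentially"
      using p(2) by (auto simp: filterlim_at)
    show "filterlim (\<lambda>j. u (p j) / (\<phi> (norm (p j)) * norm (p j) powr - d * ln (5 / norm (p j)))) at_top sequentially"
    proof (rule filterlim_at_top_mono)
      \<comment> \<open>At \<open>p j\<close> the factors a^(-d) and ln (5 / a) cancel from the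
        quotient; what remains is D / 4 times the weight 2^(-j) over \<phi> \<le> 4^(-j).\<close>
      show "filterlim (\<lambda>j. D / 4 * 2 ^ j) at_top sequentially"
      proof (rule filterlim_tendsto_pos_mult_at_top[OF tendsto_const])
        show "filterlim (\<lambda>j. 2 ^ j :: real) at_top sequentially"
          by (intro filterlim_at_infinity_imp_filterlim_at_top filterlim_realpow_sequentially_gt1) auto
      qed (use D in simp)
      show "\<forall>\<^sub>F j in sequentially. D / 4 * 2 ^ j \<le> u (p j) / (\<phi> (norm (p j)) * norm (p j) powr - d * ln (5 / norm (p j)))"
      proof (intro always_eventually allI)
        fix j
        define w L where "w = a j powr - d" and "L = ln (5 / a j)"
        have w: "w > 0" "1 / norm (p j) ^ (2 * m - 2) = w"
          unfolding w_def p d(3)[symmetric] using a(1)[of j]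
          by (auto simp: powr_minus powr_realpow inverse_eq_divide)
        have "5 / a j > 1"
          using a(1,2)[of j] by simp
        then have L: "L > 0" unfolding L_def by (rule ln_gt_zero)
        have \<phi>: "0 < \<phi> (a j)"
          using assms(6) a(1,2)[of j] by (force simp: image_subset_iff)
        \<comment> \<open>Here D > 0 becomes the logarithmic gain: the spike has height of order D
          ln (1 / a).\<close>
        have "ln (a j ^ 2 / b j) = D * ln (1 / a j)"
          using a(1)[of j] by (simp add: b_def ln_div ln_powr ln_realpow D_def algebra_simps)
        then have "step_diff m (a j ^ 2) (Lg 0) (b j) \<ge> D / 4 * L"
          using step_diff_ln_lower_bound[of "b j" "a j ^ 2" m] b(1,2)[of j] a(5)[of j] m by (simp add: p L_def)
        then have "w * (D / 4 * L) \<le> w * step_diff m (a j ^ 2) (Lg 0) (b j)"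
          using w by (intro mult_left_mono) auto
        also have "\<dots> \<le> T j (p j)"
        proof -
          have "K0 * (norm (p j) powr - d + 1) \<ge> 0"
            using K0 by (intro mult_nonneg_nonneg) auto
          then show ?thesis
            using lower[OF p(2), of j j] by (simp add: w(2)[unfolded p] p)
        qed
        finally have "(1/2) ^ j * (w * (D / 4 * L)) \<le> (1/2) ^ j * T j (p j)"
          by (intro mult_left_mono) auto
        \<comment> \<open>All terms are nonnegative, so the j-th one alone bounds the series from
          below.\<close>
        also have "\<dots> \<le> u (p j)"
        proof -
          have "0 \<le> (1/2) ^ i * T i (p j)" for i
            using T_ge[OF p(2), of j i] base_pos[of "p j"] by (intro mult_nonneg_nonneg) auto
          then show ?thesis
            using sum_le_suminf[OF sums_summable[OF sums[OF p(2)]], of "{j}" j] by (simp add: u_def)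
        qed
        finally have u: "(1/2) ^ j * (w * (D / 4 * L)) \<le> u (p j)" .
        have "D / 4 * 2 ^ j * \<phi> (a j) \<le> D / 4 * 2 ^ j * (1/4) ^ j"
          using a(4)[of j] D by (intro mult_left_mono) auto
        also have "\<dots> = D / 4 * (1/2) ^ j"
          by (simp add: mult.assoc flip: power_mult_distrib)
        finally have "D / 4 * 2 ^ j * \<phi> (a j) * (w * L) \<le> D / 4 * (1/2) ^ j * (w * L)"
          using w L by (intro mult_right_mono) auto
        also have "\<dots> \<le> u (p j)"
          using u by (simp add: mult_ac)
        finally have "D / 4 * 2 ^ j \<le> u (p j) / (\<phi> (a j) * w * L)"
          using w L \<phi> by (subst pos_le_divide_eq) (auto simp: mult_ac)
        then show "D / 4 * 2 ^ j \<le> u (p j) / (\<phi> (norm (p j)) * norm (p j) powr - d * ln (5 / norm (p j)))"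
          by (simp add: p w_def L_def)
      qed
    qed
  qed
  ultimately show ?thesis
    by blast
qed

end
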